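(* Let $f:\mathbb{R}^n\to\mathbb{R}$ and $h:\mathbb{R}^n\to\mathbb{R}^p$ be $\mathcal{C}^2$, and consider the equality-constrained SPPID dynamics $$\dot x=-M(x)^{-1}\big(\nabla f(x)+J_h(x)^\top\nu+k_p^{eq}J_h(x)^\top h(x)\big),\qquad\dot\nu=k_i^{eq}h(x),$$ where $M(x):=I_n+k_d^{eq}J_h(x)^\top J_h(x)$. Let $z^\star=(x^\star,\nu^\star)$ be a KKT point of $\min f(x)$ s.t. $h(x)=0$ at which LICQ holds. Assume SOSC holds, that is, $v^\top\nabla_x^2L(z^\star)v>0$ for all $v\in\ker J_h(x^\star)\setminus\{0\}$, where $L(x,\nu):=f(x)+\nu^\top h(x)$. Moreover, let $$\lambda_{sosc}:=\min_{v\in\ker J_h(x^\star),\ \|v\|=1}v^\top\nabla_x^2L(z^\star)v>0,$$ $$\bar k:=\max\left(0,\ \frac{2\|\nabla_x^2L(z^\star)\|^2/\lambda_{sosc}-\lambda_{\min}(\nabla_x^2L(z^\star))}{\sigma_{\min}^2(J_h(x^\star))}\right).$$ Then, for every $k_i^{eq}>0$, $k_d^{eq}\ge0$ and $k_p^{eq}>\bar k$, the equilibrium $z^\star$ is locally exponentially stable for the SPPID dynamics.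
   Context: $J_h(x)\in\mathbb{R}^{p\times n}$ is the Jacobian of $h$. $z^\star=(x^\star,\nu^\star)$ is a KKT point if $h(x^\star)=0$ and $\nabla f(x^\star)+J_h(x^\star)^\top\nu^\star=0$. LICQ at $x^\star$ means $J_h(x^\star)$ has full row rank. $\nabla_x^2L$ is the Hessian of $L$ in $x$; $\lambda_{\min}$ denotes the smallest eigenvalue of a symmetric matrix, $\sigma_{\min}(J_h(x^\star))$ the smallest singular value (so $\sigma_{\min}^2$ is the smallest eigenvalue of $J_h(x^\star)J_h(x^\star)^\top$), and $\|\cdot\|$ the Euclidean/spectral norm. *)

theory Defs
  imports "HOL-Analysis.Analysis"
begin

section \<open>Calculus\<close>

definition C2 :: "('a::real_normed_vector \<Rightarrow> 'b::real_normed_vector) \<Rightarrow> bool" where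
  "C2 g \<longleftrightarrow> (\<exists>(g' :: 'a \<Rightarrow> 'a \<Rightarrow>\<^sub>L 'b) (g'' :: 'a \<Rightarrow> 'a \<Rightarrow>\<^sub>L ('a \<Rightarrow>\<^sub>L 'b)).
     (\<forall>x. (g has_derivative blinfun_apply (g' x)) (at x)) \<and>
     (\<forall>x. (g' has_derivative blinfun_apply (g'' x)) (at x)) \<and>
     continuous_on UNIV g'')"

definition gradient :: "(real^'n \<Rightarrow> real) \<Rightarrow> real^'n \<Rightarrow> real^'n" where
  "gradient g x = (\<chi> i. frechet_derivative g (at x) (axis i 1))"

definition hessian :: "(real^'n \<Rightarrow> real) \<Rightarrow> real^'n \<Rightarrow> real^'n^'n" where
  "hessian g x = jacobian (gradient g) (at x)"

section \<open>Spectral quantities\<close>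

definition lambda_min :: "real^'n^'n \<Rightarrow> real" where
  "lambda_min A = (LEAST c. \<exists>v. v \<noteq> 0 \<and> A *v v = c *\<^sub>R v)"

text \<open>Intended for matrices with at most as many rows as columns, which is the only case
  compatible with full row rank.\<close>

definition sigma_min :: "real^'n^'p \<Rightarrow> real" where
  "sigma_min A = sqrt (lambda_min (A ** transpose A))"

text \<open>The library's \<^const>\<open>norm\<close> on \<open>real^'n^'p\<close> is the Frobenius norm; the spectral norm
  is the operator norm.\<close>

definition spectral_norm :: "real^'n^'p \<Rightarrow> real" where
  "spectral_norm A = onorm ((*v) A)"

section \<open>The constrained problem\<close>

definition lagrangian ::
  "(real^'n \<Rightarrow> real) \<Rightarrow> (real^'n \<Rightarrow> real^'p) \<Rightarrow> real^'n \<Rightarrow> real^'p \<Rightarrow> real" where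
  "lagrangian f h x \<nu> = f x + \<nu> \<bullet> h x"

definition hessian_L ::
  "(real^'n \<Rightarrow> real) \<Rightarrow> (real^'n \<Rightarrow> real^'p) \<Rightarrow> real^'n \<Rightarrow> real^'p \<Rightarrow> real^'n^'n" where
  "hessian_L f h x \<nu> = hessian (\<lambda>y. lagrangian f h y \<nu>) x"

definition kkt_point ::
  "(real^'n \<Rightarrow> real) \<Rightarrow> (real^'n \<Rightarrow> real^'p) \<Rightarrow> real^'n \<Rightarrow> real^'p \<Rightarrow> bool" where
  "kkt_point f h x \<nu> \<longleftrightarrow>
     h x = 0 \<and> gradient f x + transpose (jacobian h (at x)) *v \<nu> = 0"

definition LICQ :: "(real^'n \<Rightarrow> real^'p) \<Rightarrow> real^'n \<Rightarrow> bool" where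
  "LICQ h x \<longleftrightarrow> rank (jacobian h (at x)) = CARD('p)"

definition SOSC ::
  "(real^'n \<Rightarrow> real) \<Rightarrow> (real^'n \<Rightarrow> real^'p) \<Rightarrow> real^'n \<Rightarrow> real^'p \<Rightarrow> bool" where
  "SOSC f h x \<nu> \<longleftrightarrow>
     (\<forall>v. jacobian h (at x) *v v = 0 \<and> v \<noteq> 0 \<longrightarrow> v \<bullet> (hessian_L f h x \<nu> *v v) > 0)"

text \<open>If the kernel of the Jacobian is nontrivial, the infimum below is the minimum of a continuous
  function over a compact set (see \<open>lambda_sosc_attained\<close>). Under LICQ the kernel is trivial exactly
  if there are as many constraints as variables; the minimum is then over the empty set and takes
  the value \<open>\<infinity>\<close>, so that the first quotient in \<open>k_bar\<close> is \<open>0\<close>.\<close>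

definition lambda_sosc ::
  "(real^'n \<Rightarrow> real) \<Rightarrow> (real^'n \<Rightarrow> real^'p) \<Rightarrow> real^'n \<Rightarrow> real^'p \<Rightarrow> ereal" where
  "lambda_sosc f h x \<nu> =
     (INF v \<in> {v. jacobian h (at x) *v v = 0 \<and> norm v = 1}. ereal (v \<bullet> (hessian_L f h x \<nu> *v v)))"

definition k_bar ::
  "(real^'n \<Rightarrow> real) \<Rightarrow> (real^'n \<Rightarrow> real^'p) \<Rightarrow> real^'n \<Rightarrow> real^'p \<Rightarrow> ereal" where
  "k_bar f h x \<nu> =
     max 0 ((ereal (2 * (spectral_norm (hessian_L f h x \<nu>))\<^sup>2) / lambda_sosc f h x \<nu>
               - ereal (lambda_min (hessian_L f h x \<nu>)))
            / ereal ((sigma_min (jacobian h (at x)))\<^sup>2))"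

lemma lambda_sosc_attained:
  assumes "\<exists>w. jacobian h (at x) *v w = 0 \<and> w \<noteq> 0"
  shows "\<exists>v. jacobian h (at x) *v v = 0 \<and> norm v = 1 \<and>
           lambda_sosc f h x \<nu> = ereal (v \<bullet> (hessian_L f h x \<nu> *v v))"
proof -
  let ?J = "jacobian h (at x)" and ?H = "hessian_L f h x \<nu>"
  let ?S = "{v. ?J *v v = 0 \<and> norm v = 1}"
  have S: "?S = sphere 0 1 \<inter> {v. ?J *v v = 0}"
    by auto
  have "closed {v. ?J *v v = 0}"
    by (intro closed_Collect_eq continuous_intros matrix_vector_mult_linear_continuous_on)
  then have "compact ?S"
    unfolding S by (intro compact_Int_closed compact_sphere)
  moreover have "?S \<noteq> {}"
  proof -
    from assms obtain w where w: "?J *v w = 0" "w \<noteq> 0" by blast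
    then have "(1 / norm w) *\<^sub>R w \<in> ?S"
      by (simp add: matrix_vector_mult_scaleR)
    then show ?thesis by blast
  qed
  moreover have "continuous_on ?S (\<lambda>v. v \<bullet> (?H *v v))"
    by (intro continuous_intros matrix_vector_mult_linear_continuous_on)
  ultimately obtain v where v: "v \<in> ?S" "\<forall>y\<in>?S. v \<bullet> (?H *v v) \<le> y \<bullet> (?H *v y)"
    using continuous_attains_inf by blast
  then have "lambda_sosc f h x \<nu> = ereal (v \<bullet> (?H *v v))"
    unfolding lambda_sosc_def by (intro INF_eqI) auto
  with v show ?thesis by blast
qed

lemma lambda_sosc_pos:
  assumes "SOSC f h x \<nu>"
  shows "lambda_sosc f h x \<nu> > 0"
proof (cases "\<exists>w. jacobian h (at x) *v w = 0 \<and> w \<noteq> 0")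
  case True
  from lambda_sosc_attained[OF True, of f \<nu>] obtain v where
    v: "jacobian h (at x) *v v = 0" "norm v = 1"
       "lambda_sosc f h x \<nu> = ereal (v \<bullet> (hessian_L f h x \<nu> *v v))" by blast
  then have "v \<noteq> 0" by auto
  with assms v show ?thesis by (simp add: SOSC_def)
next
  case False
  then have "{v. jacobian h (at x) *v v = 0 \<and> norm v = 1} = {}" by force
  then show ?thesis by (simp only: lambda_sosc_def) (simp add: top_ereal_def)
qed

section \<open>The dynamics\<close>

definition sppid_mass :: "(real^'n \<Rightarrow> real^'p) \<Rightarrow> real \<Rightarrow> real^'n \<Rightarrow> real^'n^'n" where
  "sppid_mass h kd x = mat 1 + kd *\<^sub>R (transpose (jacobian h (at x)) ** jacobian h (at x))"

definition sppid_field ::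
  "(real^'n \<Rightarrow> real) \<Rightarrow> (real^'n \<Rightarrow> real^'p) \<Rightarrow> real \<Rightarrow> real \<Rightarrow> real
     \<Rightarrow> (real^'n) \<times> (real^'p) \<Rightarrow> (real^'n) \<times> (real^'p)" where
  "sppid_field f h kp ki kd = (\<lambda>(x, \<nu>).
     (- (matrix_inv (sppid_mass h kd x) *v
           (gradient f x + transpose (jacobian h (at x)) *v \<nu>
              + kp *\<^sub>R (transpose (jacobian h (at x)) *v h x))),
      ki *\<^sub>R h x))"

section \<open>Local exponential stability\<close>

definition solution_on ::
  "('a::real_normed_vector \<Rightarrow> 'a) \<Rightarrow> (real \<Rightarrow> 'a) \<Rightarrow> real set \<Rightarrow> bool" where
  "solution_on F z I \<longleftrightarrow> (\<forall>t\<in>I. (z has_vector_derivative F (z t)) (at t within I))"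

text \<open>The bound is required of every solution on every interval \<open>[0, T]\<close>, hence also of every
  solution on \<open>[0, \<infinity>)\<close>; existence of a solution for all \<open>t \<ge> 0\<close> is part of the definition, so
  that the bound is never satisfied vacuously.\<close>

definition locally_exponentially_stable ::
  "('a::real_normed_vector \<Rightarrow> 'a) \<Rightarrow> 'a \<Rightarrow> bool" where
  "locally_exponentially_stable F zs \<longleftrightarrow>
     F zs = 0 \<and>
     (\<exists>r>0. \<exists>C>0. \<exists>\<alpha>>0. \<forall>z0. norm (z0 - zs) < r \<longrightarrow>
        (\<exists>z. z 0 = z0 \<and> solution_on F z {0..}) \<and>
        (\<forall>z T. z 0 = z0 \<and> solution_on F z {0..T} \<longrightarrow>
           (\<forall>t\<in>{0..T}. norm (z t - zs) \<le> C * exp (- \<alpha> * t) * norm (z0 - zs))))"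

end

theory Submission
  imports Defs
begin

text \<open>
  Let \<open>J\<close> be the Jacobian of \<open>h\<close> at \<open>x\<^sup>*\<close>, \<open>H\<close> the Hessian of the Lagrangian and \<open>M\<close> the mass matrix there.
  Splitting a vector into its components in the kernel and the row space of \<open>J\<close>, the bound on the gain
  makes \<open>B = H + k\<^sub>p J\<^sup>T J\<close> positive definite: the two norms enter through a binary quadratic form, and the gain
  condition says that it is definite. The linearization in \<open>(e, w)\<close> is
  \<open>M e' = - (B e + J\<^sup>T w)\<close>, \<open>w' = k\<^sub>i J e\<close>, and
  \<open>e \<bullet> M e + (norm w)\<^sup>2 / k\<^sub>i + 2 \<epsilon> w \<bullet> J M e\<close> is for small \<open>\<epsilon>\<close> a strict Lyapunov function for it, because
  \<open>J\<^sup>T\<close> is injective. A strict quadratic Lyapunov function of the linearization survives the passage to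
  the nonlinear field near the equilibrium and traps solutions, which therefore exist globally.
\<close>

section \<open>Exponential stability from a quadratic Lyapunov function\<close>

text \<open>The obstacle is the nonlinear field: it contains the inverse of a matrix that varies
  with \<open>x\<close>, and \<open>J\<close> is only C1. This inverse is never differentiated. With
  \<open>g\<close> the bracket in the first equation, \<open>y = M^-1 g\<close> is handled through
  \<open>M y = g\<close>: coercivity of \<open>M\<close> with constant one gives Lipschitz bounds,
  and since \<open>g\<close> and hence \<open>y\<close> vanish at the equilibrium, the variation of
  \<open>M\<close> enters only at second order.

  \<open>H\<close> appears in the linearization because the multiplier is split as \<nu>s plus the
  deviation from \<nu>s: with the multiplier frozen at \<nu>s, the bracket contains the gradient of
  the Lagrangian, and the remaining terms are products with a factor that vanishes at the
  equilibrium.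

  \<open>lambda_min\<close> is a least real eigenvalue. It bounds the quadratic form of
  \<open>H\<close> from below because \<open>H\<close> is symmetric, which is why the symmetry of
  second derivatives is established.\<close>

lemma indefinite_integral_has_vector_derivative:
  fixes g :: "real \<Rightarrow> 'a::banach"
  assumes "continuous_on {a..} g" "t \<ge> a"
  shows "((\<lambda>u. integral {a..u} g) has_vector_derivative g t) (at t within {a..})"
proof -
  have "((\<lambda>u. integral {a..u} g) has_vector_derivative g t) (at t within {a..t+1})"
    using assms by (intro integral_has_vector_derivative) (auto elim: continuous_on_subset)
  moreover have "at t within {a..} = at t within {a..t+1}"
    by (rule at_within_nhd[of _ "{..<t+1}"]) auto
  ultimately show ?thesis by simp
qed

lemma integral_exp_le:
  fixes k t :: real
  assumes "k > 0" "t \<ge> 0"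
  shows "(\<lambda>s. exp (k * s)) integrable_on {0..t}" "integral {0..t} (\<lambda>s. exp (k * s)) \<le> exp (k * t) / k"
proof -
  have "((\<lambda>s. exp (k * s)) has_integral (exp (k * t) / k - exp (k * 0) / k)) {0..t}"
    using assms
    by (intro fundamental_theorem_of_calculus)
       (auto intro!: derivative_eq_intros simp: has_real_derivative_iff_has_vector_derivative[symmetric])
  then show "(\<lambda>s. exp (k * s)) integrable_on {0..t}" "integral {0..t} (\<lambda>s. exp (k * s)) \<le> exp (k * t) / k"
    using assms by (auto simp: has_integral_integrable_integral)
qed

lemma lipschitz_global_solution:
  fixes F :: "'a::banach \<Rightarrow> 'a"
  assumes "L-lipschitz_on UNIV F"
  shows "\<exists>z. z 0 = z0 \<and> solution_on F z {0..}"
proof -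
  text \<open>The Picard operator is a contraction for the norm weighted by \<open>exp (- k t)\<close>, with \<open>k\<close> twice the
    Lipschitz constant; the solution is written as \<open>z0 + exp (k t) u\<close> with \<open>u\<close> bounded.\<close>
  define K where "K = L + 1"
  have L0: "L \<ge> 0" using assms by (rule lipschitz_on_nonneg)
  then have K: "K > 0" by (simp add: K_def)
  have Lip: "norm (F x - F y) \<le> K * norm (x - y)" for x y
    using lipschitz_on_normD[OF assms, of x y] by (simp add: K_def distrib_right add_increasing2)
  have contF: "continuous_on UNIV F" using assms by (rule lipschitz_on_continuous_on)
  define k where "k = 2 * K"
  have k: "k > 0" using K by (simp add: k_def)
  define y where "y u s = z0 + exp (k * s) *\<^sub>R apply_bcontfun u s" for u :: "real \<Rightarrow>\<^sub>C 'a" and s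
  define I where "I u t = integral {0..t} (\<lambda>s. F (y u s))" for u t
  have conty: "continuous_on S (\<lambda>s. F (y u s))" for u S
    unfolding y_def by (rule continuous_on_compose2[OF contF]) (auto intro!: continuous_intros)
  have I: "(I u has_vector_derivative F (y u t)) (at t within {0..})" if "t \<ge> 0" for u t
    unfolding I_def using indefinite_integral_has_vector_derivative[OF conty] that by auto
  have contI: "continuous_on {0..} (I u)" for u
    using has_vector_derivative_continuous[OF I] by (auto simp: continuous_on_eq_continuous_within)
  have bnd: "norm (integral {0..t} g) \<le> C * exp (k * t) / k"
    if "continuous_on {0..t} g" "\<And>s. s \<ge> 0 \<Longrightarrow> norm (g s) \<le> C * exp (k * s)" "t \<ge> 0"
    for g :: "real \<Rightarrow> 'a" and C t
  proof -
    have "norm (g 0) \<le> C" using that(2)[of 0] by simp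
    then have C: "C \<ge> 0" using norm_ge_zero order_trans by blast
    have "norm (integral {0..t} g) \<le> integral {0..t} (\<lambda>s. C * exp (k * s))"
      using that integral_exp_le[OF k]
      by (intro integral_norm_bound_integral integrable_continuous_real integrable_on_cmult_left)
         (auto intro!: continuous_intros)
    also have "\<dots> = C * integral {0..t} (\<lambda>s. exp (k * s))" by simp
    also have "\<dots> \<le> C * (exp (k * t) / k)"
      using integral_exp_le[OF k] that C by (intro mult_left_mono) auto
    finally show ?thesis by simp
  qed
  \<comment> \<open>Bounded continuous functions live on the whole line, so the operator is extended
    to negative times by its value at 0.\<close>
  define T where "T u t = exp (- k * max 0 t) *\<^sub>R I u (max 0 t)" for u t
  have Tb: "T u \<in> bcontfun" for u
  proof (rule bcontfun_normI)
    show "continuous_on UNIV (T u)" unfolding T_def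
      by (intro continuous_intros continuous_on_compose2[OF contI]) auto
    fix t
    have "norm (F (y u s)) \<le> (norm (F z0) + K * norm u) * exp (k * s)" if "s \<ge> 0" for s
    proof -
      have "norm (F (y u s)) \<le> norm (F z0) + norm (F (y u s) - F z0)"
        by (metis add.commute norm_triangle_sub)
      also have "\<dots> \<le> norm (F z0) + K * (exp (k * s) * norm u)"
        using order_trans[OF Lip[of "y u s" z0] mult_left_mono[of _ "exp (k * s) * norm u"]]
          norm_bounded[of u s] K
        by (simp add: y_def)
      \<comment> \<open>For \<open>s \<ge> 0\<close> the weight is at least 1, so the constant term
        can be put under it as well.\<close>
      also have "\<dots> \<le> norm (F z0) * exp (k * s) + K * (exp (k * s) * norm u)"
        using that k by (simp add: mult_le_cancel_left1)
      finally show ?thesis by (simp add: algebra_simps)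
    qed
    then have "norm (I u (max 0 t)) \<le> (norm (F z0) + K * norm u) * exp (k * max 0 t) / k"
      unfolding I_def by (intro bnd conty) auto
    then have "exp (- k * max 0 t) * norm (I u (max 0 t))
        \<le> exp (- k * max 0 t) * ((norm (F z0) + K * norm u) * exp (k * max 0 t) / k)"
      by (intro mult_left_mono) auto
    also have "\<dots> = (norm (F z0) + K * norm u) / k"
      by (simp add: exp_minus divide_simps)
    finally show "norm (T u t) \<le> (norm (F z0) + K * norm u) / k" by (simp add: T_def)
  qed
  have app: "apply_bcontfun (Bcontfun (T u)) = T u" for u using Tb by (rule Bcontfun_inverse)
  have "dist (Bcontfun (T u)) (Bcontfun (T w)) \<le> 1/2 * dist u w" for u w
  proof (rule dist_bound)
    fix t :: real
    define m where "m = max 0 t"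
    have m: "m \<ge> 0" by (simp add: m_def)
    have "norm (F (y u s) - F (y w s)) \<le> (K * dist u w) * exp (k * s)" for s
    proof -
      have "norm (F (y u s) - F (y w s)) \<le> K * (exp (k * s) * dist (u s) (w s))"
        using Lip[of "y u s" "y w s"] by (simp add: y_def dist_norm flip: scaleR_diff_right)
      also have "\<dots> \<le> K * (exp (k * s) * dist u w)"
        using K by (intro mult_left_mono dist_bounded) auto
      finally show ?thesis by (simp add: algebra_simps)
    qed
    then have "norm (integral {0..m} (\<lambda>s. F (y u s) - F (y w s))) \<le> (K * dist u w) * exp (k * m) / k"
      using m by (intro bnd continuous_intros conty) auto
    also have "\<dots> = 1/2 * dist u w * exp (k * m)" using K by (simp add: k_def)
    also have "integral {0..m} (\<lambda>s. F (y u s) - F (y w s)) = I u m - I w m"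
      unfolding I_def by (intro integral_diff integrable_continuous_real conty)
    finally have "exp (- k * m) * norm (I u m - I w m) \<le> exp (- k * m) * (1/2 * dist u w * exp (k * m))"
      by (intro mult_left_mono) auto
    also have "\<dots> = 1/2 * dist u w" by (simp add: exp_minus)
    finally show "dist (Bcontfun (T u) t) (Bcontfun (T w) t) \<le> 1/2 * dist u w"
      by (simp add: app T_def dist_norm flip: m_def scaleR_diff_right)
  qed
  then obtain u where "Bcontfun (T u) = u"
    using banach_fix_type[of "1/2" "\<lambda>u. Bcontfun (T u)"] by auto
  then have u: "apply_bcontfun u = T u" using app by metis
  \<comment> \<open>The weight and its inverse cancel, so the fixed point satisfies the integral
    equation.\<close>
  have yI: "y u t = z0 + I u t" if "t \<ge> 0" for t
    using that fun_cong[OF u, of t] by (simp add: y_def T_def exp_minus)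
  have "(y u has_vector_derivative F (y u t)) (at t within {0..})" if "t \<ge> 0" for t
  proof (rule has_vector_derivative_transform)
    show "((\<lambda>t. z0 + I u t) has_vector_derivative F (y u t)) (at t within {0..})"
      using I[OF that] by (auto intro!: derivative_eq_intros)
  qed (use that yI in auto)
  moreover have "y u 0 = z0" using yI[of 0] by (simp add: I_def)
  ultimately show ?thesis unfolding solution_on_def by (metis atLeast_iff)
qed

section \<open>Trapping and decay of solutions\<close>

lemma solution_on_subset:
  "solution_on F z I \<Longrightarrow> J \<subseteq> I \<Longrightarrow> solution_on F z J"
  unfolding solution_on_def by (meson has_vector_derivative_within_subset subsetD)

text \<open>Decay of the energy and trapping in the ball depend on each other. A first exit time
  breaks the circle: up to it decay holds, so the energy there is below \<open>c * R^2\<close>,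
  while a point at distance at least \<open>R\<close> has energy at least
  \<open>c * R^2\<close>.\<close>

lemma lyapunov_estimate:
  fixes F :: "'a::real_inner \<Rightarrow> 'a"
  assumes P: "bounded_linear P" and sym: "\<And>u v. u \<bullet> P v = P u \<bullet> v"
    and c: "c > 0" "\<And>v. c * (norm v)\<^sup>2 \<le> v \<bullet> P v"
    and D: "D > 0" "\<And>v. v \<bullet> P v \<le> D * (norm v)\<^sup>2"
    and \<gamma>: "\<gamma> > 0"
    and decr: "\<And>z. norm (z - zs) < R \<Longrightarrow> P (z - zs) \<bullet> F z \<le> - \<gamma> * (norm (z - zs))\<^sup>2"
    and z0: "D * (norm (z 0 - zs))\<^sup>2 < c * R\<^sup>2"
    and R: "R > 0"
    and sol: "solution_on F z {0..T}" and t: "t \<in> {0..T}"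
  shows "norm (z t - zs) < R"
    and "c * (norm (z t - zs))\<^sup>2 \<le> D * exp (- (2 * \<gamma> / D) * t) * (norm (z 0 - zs))\<^sup>2"
proof -
  interpret P: bounded_linear P by fact
  \<comment> \<open>The energy has derivative at most \<open>- 2 * \<gamma> * (norm e)^2\<close> and
    is itself at most \<open>D * (norm e)^2\<close>; the rate is the quotient.\<close>
  define \<beta> where "\<beta> = 2 * \<gamma> / D"
  have \<beta>: "\<beta> > 0" using D \<gamma> by (simp add: \<beta>_def)
  define \<phi> where "\<phi> s = (z s - zs) \<bullet> P (z s - zs)" for s
  have d\<phi>: "(\<phi> has_vector_derivative 2 * (P (z s - zs) \<bullet> F (z s))) (at s within {0..T})" if "s \<in> {0..T}" for s
  proof -
    have *: "(z has_derivative (\<lambda>h. h *\<^sub>R F (z s))) (at s within {0..T})"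
      using sol that by (auto simp: solution_on_def has_vector_derivative_def)
    have e: "((\<lambda>s. z s - zs) has_derivative (\<lambda>h. h *\<^sub>R F (z s))) (at s within {0..T})"
      using has_derivative_diff[OF * has_derivative_const] by simp
    have "(\<lambda>h. (z s - zs) \<bullet> P (h *\<^sub>R F (z s)) + h *\<^sub>R F (z s) \<bullet> P (z s - zs))
        = (\<lambda>h. h *\<^sub>R (2 * (P (z s - zs) \<bullet> F (z s))))"
      using sym[of "z s - zs" "F (z s)"] inner_commute[of "F (z s)" "P (z s - zs)"]
      by (simp only: P.scaleR inner_scaleR_left inner_scaleR_right) (simp add: fun_eq_iff)
    with has_derivative_inner[OF e P.has_derivative[OF e]] show ?thesis
      unfolding \<phi>_def has_vector_derivative_def by simp
  qed
  have contz: "continuous_on {0..T} z"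
    using sol has_vector_derivative_continuous unfolding solution_on_def
    by (force simp: continuous_on_eq_continuous_within)
  have cont\<phi>: "continuous_on {0..T} \<phi>"
    unfolding \<phi>_def by (intro continuous_intros contz P.continuous_on)
  have decay: "\<phi> \<tau> \<le> exp (- \<beta> * \<tau>) * \<phi> 0"
    if \<tau>: "\<tau> \<in> {0..T}" and trapped: "\<And>s. 0 < s \<Longrightarrow> s < \<tau> \<Longrightarrow> norm (z s - zs) < R" for \<tau>
  proof -
    have "exp (\<beta> * \<tau>) * \<phi> \<tau> \<le> exp (\<beta> * 0) * \<phi> 0"
    \<comment> \<open>The sign of the derivative is required at interior times only. Hence trapping
      is assumed strictly before \<tau>, and \<tau> may be the first exit time.\<close>
    proof (rule DERIV_nonpos_imp_decreasing_open[of 0 \<tau> "\<lambda>s. exp (\<beta> * s) * \<phi> s"])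
      fix s assume s: "0 < s" "s < \<tau>"
      have "(\<phi> has_vector_derivative 2 * (P (z s - zs) \<bullet> F (z s))) (at s)"
        using d\<phi>[of s] s \<tau> at_within_interior[of s "{0..T}"] by simp
      then have "((\<lambda>s. exp (\<beta> * s) * \<phi> s) has_real_derivative
          exp (\<beta> * s) * (\<beta> * \<phi> s + 2 * (P (z s - zs) \<bullet> F (z s)))) (at s)"
        unfolding has_real_derivative_iff_has_vector_derivative[symmetric]
        by (auto intro!: derivative_eq_intros simp: algebra_simps)
      moreover have "\<beta> * \<phi> s + 2 * (P (z s - zs) \<bullet> F (z s)) \<le> 0"
      proof -
        have "\<beta> * \<phi> s \<le> \<beta> * (D * (norm (z s - zs))\<^sup>2)"
          unfolding \<phi>_def using \<beta> D by (intro mult_left_mono) auto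
        then show ?thesis using decr[OF trapped[OF s]] D by (simp add: \<beta>_def)
      qed
      ultimately show "\<exists>y. ((\<lambda>s. exp (\<beta> * s) * \<phi> s) has_real_derivative y) (at s) \<and> y \<le> 0"
        by (meson exp_ge_zero mult_nonneg_nonpos)
    qed (use \<tau> in \<open>auto intro!: continuous_intros continuous_on_subset[OF cont\<phi>]\<close>)
    then show ?thesis by (simp add: exp_minus field_simps)
  qed
  have trapped: "norm (z s - zs) < R" if "s \<in> {0..T}" for s
  proof (rule ccontr)
    assume "\<not> norm (z s - zs) < R"
    define S where "S = {0..T} \<inter> (\<lambda>s. norm (z s - zs)) -` {R..}"
    have "closed S"
      unfolding S_def by (intro continuous_closed_preimage continuous_intros contz)
    then have "compact S"
      unfolding compact_eq_bounded_closed S_def by (auto intro: bounded_Int)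
    moreover have "s \<in> S" using that \<open>\<not> _\<close> by (auto simp: S_def)
    ultimately obtain \<tau> where \<tau>: "\<tau> \<in> S" "\<And>s. s \<in> S \<Longrightarrow> \<tau> \<le> s"
      using compact_attains_inf[of S] by blast
    have "\<phi> \<tau> \<le> exp (- \<beta> * \<tau>) * \<phi> 0"
    proof (rule decay)
      show "\<tau> \<in> {0..T}" using \<tau>(1) by (simp add: S_def)
      show "norm (z s - zs) < R" if "0 < s" "s < \<tau>" for s
        using \<tau>(1) \<tau>(2)[of s] that by (force simp: S_def)
    qed
    also have "\<dots> \<le> D * (norm (z 0 - zs))\<^sup>2"
    proof -
      have "0 \<le> \<phi> 0" unfolding \<phi>_def using c by (meson mult_nonneg_nonneg order_trans less_imp_le zero_le_power2)
      moreover have "exp (- \<beta> * \<tau>) \<le> 1" using \<tau> \<beta> by (auto simp: S_def)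
      ultimately have "exp (- \<beta> * \<tau>) * \<phi> 0 \<le> \<phi> 0" by (simp add: mult_left_le_one_le)
      then show ?thesis using D(2)[of "z 0 - zs"] by (simp add: \<phi>_def)
    qed
    also have "\<dots> < c * R\<^sup>2" by fact
    also have "\<dots> \<le> c * (norm (z \<tau> - zs))\<^sup>2"
      using \<tau> c R by (auto simp: S_def intro!: mult_left_mono power_mono)
    also have "\<dots> \<le> \<phi> \<tau>" using c by (simp add: \<phi>_def)
    finally show False by simp
  qed
  then show "norm (z t - zs) < R" using t by blast
  have "c * (norm (z t - zs))\<^sup>2 \<le> \<phi> t" using c by (simp add: \<phi>_def)
  also have "\<dots> \<le> exp (- \<beta> * t) * \<phi> 0" using t trapped by (intro decay) auto
  also have "\<dots> \<le> exp (- \<beta> * t) * (D * (norm (z 0 - zs))\<^sup>2)"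
    using D by (intro mult_left_mono) (auto simp: \<phi>_def)
  finally show "c * (norm (z t - zs))\<^sup>2 \<le> D * exp (- (2 * \<gamma> / D) * t) * (norm (z 0 - zs))\<^sup>2"
    by (simp only: \<beta>_def mult.commute[of D] mult.assoc)
qed

text \<open>The decrease estimate uses the derivative at \<open>zs\<close> alone: the remainder is
  small relative to \<open>norm (z - zs)\<close>, and half of the rate \<gamma> absorbs it. The
  Lipschitz bound serves the existence of solutions.\<close>

theorem locally_exponentially_stable_linearization:
  fixes F :: "'a::euclidean_space \<Rightarrow> 'a"
  assumes lip: "L-lipschitz_on (cball zs R) F" and R: "R > 0"
    and eq: "F zs = 0" and der: "(F has_derivative A) (at zs)"
    and P: "bounded_linear P" and sym: "\<And>u v. u \<bullet> P v = P u \<bullet> v"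
    and c: "c > 0" "\<And>v. c * (norm v)\<^sup>2 \<le> v \<bullet> P v"
    and \<gamma>: "\<gamma> > 0" "\<And>v. P v \<bullet> A v \<le> - \<gamma> * (norm v)\<^sup>2"
  shows "locally_exponentially_stable F zs"
proof -
  interpret P: bounded_linear P by fact
  obtain D where D: "D > 0" "\<And>v. norm (P v) \<le> norm v * D" using P.pos_bounded by blast
  have D2: "v \<bullet> P v \<le> D * (norm v)\<^sup>2" for v
    using Cauchy_Schwarz_ineq2[of v "P v"] mult_left_mono[OF D(2), of "norm v" v]
    by (simp add: power2_eq_square algebra_simps)
  \<comment> \<open>Chosen so that the remainder, paired with \<open>P e\<close>, costs at most
    \<open>D * \<eta> = \<gamma> / 2\<close>.\<close>
  define \<eta> where "\<eta> = \<gamma> / (2 * D)"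
  have "\<eta> > 0" using \<gamma> D by (simp add: \<eta>_def)
  then obtain d where d: "d > 0"
    "\<And>z. norm (z - zs) < d \<Longrightarrow> norm (F z - F zs - A (z - zs)) \<le> \<eta> * norm (z - zs)"
    using der unfolding has_derivative_at_alt by blast
  define \<gamma>' where "\<gamma>' = \<gamma> / 2"
  have \<gamma>': "\<gamma>' > 0" using \<gamma> by (simp add: \<gamma>'_def)
  define R' where "R' = min R d"
  have R': "R' > 0" using R d by (simp add: R'_def)
  have decr: "P (z - zs) \<bullet> F z \<le> - \<gamma>' * (norm (z - zs))\<^sup>2" if "norm (z - zs) < R'" for z
  proof -
    let ?e = "z - zs"
    have "P ?e \<bullet> F z = P ?e \<bullet> A ?e + P ?e \<bullet> (F z - F zs - A ?e)"
      by (simp add: eq algebra_simps)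
    also have "P ?e \<bullet> (F z - F zs - A ?e) \<le> (norm ?e * D) * (\<eta> * norm ?e)"
      using Cauchy_Schwarz_ineq2[of "P ?e" "F z - F zs - A ?e"] d(2)[of z] that D(2)[of ?e] D(1)
        mult_mono[of "norm (P ?e)" "norm ?e * D" "norm (F z - F zs - A ?e)" "\<eta> * norm ?e"]
      by (auto simp: R'_def)
    also have "\<dots> = \<gamma>' * (norm ?e)\<^sup>2"
      using D by (simp add: \<eta>_def \<gamma>'_def power2_eq_square)
    finally show ?thesis using \<gamma>(2)[of ?e] by (simp add: \<gamma>'_def)
  qed
  text \<open>Composing with the projection onto the ball makes the field globally Lipschitz without changing
    it where the Lyapunov estimate traps the solution.\<close>
  define p where "p = closest_point (cball zs R)"
  have pball: "p x \<in> cball zs R" for x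
    unfolding p_def using R by (intro closest_point_in_set) auto
  have pid: "p x = x" if "norm (x - zs) < R'" for x
    unfolding p_def using that by (intro closest_point_self) (auto simp: R'_def dist_norm norm_minus_commute)
  have "1-lipschitz_on UNIV p"
    unfolding p_def using R by (intro lipschitz_onI) (auto intro!: closest_point_lipschitz)
  moreover have "L-lipschitz_on (p ` UNIV) F"
    using lip pball by (auto intro: lipschitz_on_subset)
  ultimately have "(L * 1)-lipschitz_on UNIV (F \<circ> p)" by (rule lipschitz_on_compose)
  note global = lipschitz_global_solution[OF this]
  have decr': "P (z - zs) \<bullet> (F \<circ> p) z \<le> - \<gamma>' * (norm (z - zs))\<^sup>2" if "norm (z - zs) < R'" for z
    using decr[OF that] pid[OF that] by simp
  \<comment> \<open>\<open>D * r^2 = c * R'^2\<close> is the threshold for trapping.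
    \<open>C\<close> and \<alpha> are a square root and a halved rate because the Lyapunov estimate
    is about squared norms.\<close>
  define r where "r = R' * sqrt (c / D)"
  define C where "C = sqrt (D / c)"
  define \<alpha> where "\<alpha> = \<gamma>' / D"
  have pos: "r > 0" "C > 0" "\<alpha> > 0" using R' c D \<gamma>' by (auto simp: r_def C_def \<alpha>_def)
  show ?thesis unfolding locally_exponentially_stable_def
  proof (rule conjI[OF eq], rule exI[of _ r], rule conjI[OF pos(1)], rule exI[of _ C],
      rule conjI[OF pos(2)], rule exI[of _ \<alpha>], rule conjI[OF pos(3)])
    show "\<forall>z0. norm (z0 - zs) < r \<longrightarrow>
        (\<exists>z. z 0 = z0 \<and> solution_on F z {0..}) \<and>
        (\<forall>z T. z 0 = z0 \<and> solution_on F z {0..T} \<longrightarrow>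
           (\<forall>t\<in>{0..T}. norm (z t - zs) \<le> C * exp (- \<alpha> * t) * norm (z0 - zs)))"
    proof (intro allI impI conjI ballI)
    fix z0 assume z0: "norm (z0 - zs) < r"
    have "(norm (z0 - zs))\<^sup>2 < r\<^sup>2" using z0 by (intro power_strict_mono) auto
    also have "r\<^sup>2 = c * R'\<^sup>2 / D" using c D by (simp add: r_def power_mult_distrib)
    finally have z0': "D * (norm (z0 - zs))\<^sup>2 < c * R'\<^sup>2" using D by (simp add: field_simps)
    obtain z where z: "z 0 = z0" "solution_on (F \<circ> p) z {0..}" using global by blast
    have "norm (z t - zs) < R'" if "t \<ge> 0" for t
      by (rule lyapunov_estimate(1)[OF P sym c D(1) D2 \<gamma>' decr', where T=t])
         (use z z0' R' that in \<open>auto simp del: o_apply intro: solution_on_subset\<close>)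
    then have "solution_on F z {0..}"
      using z(2) by (auto simp: solution_on_def pid)
    with z show "\<exists>z. z 0 = z0 \<and> solution_on F z {0..}" by blast
    fix z T t assume z: "z 0 = z0 \<and> solution_on F z {0..T}" and t: "t \<in> {0..T}"
    have "c * (norm (z t - zs))\<^sup>2 \<le> D * exp (- (2 * \<gamma>' / D) * t) * (norm (z 0 - zs))\<^sup>2"
      by (rule lyapunov_estimate(2)[OF P sym c D(1) D2 \<gamma>' decr])
         (use z z0' R' t in auto)
    then have "(norm (z t - zs))\<^sup>2 \<le> (D / c) * exp (2 * (- \<alpha> * t)) * (norm (z0 - zs))\<^sup>2"
      using c z by (simp add: \<alpha>_def field_simps)
    also have "\<dots> = (C * exp (- \<alpha> * t) * norm (z0 - zs))\<^sup>2"
      unfolding exp_double power_mult_distrib using c D by (simp add: C_def)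
    finally show "norm (z t - zs) \<le> C * exp (- \<alpha> * t) * norm (z0 - zs)"
      by (rule power2_le_imp_le) (use pos in simp)
    qed
  qed
qed

section \<open>Symmetry of second derivatives\<close>

text \<open>The second difference is an increment along \<open>u\<close> of an increment along
  \<open>v\<close>, so the mean value theorem applies once in each direction.\<close>

lemma second_difference_mean_value:
  fixes g :: "'a::real_normed_vector \<Rightarrow> real"
    and g' :: "'a \<Rightarrow> 'a \<Rightarrow>\<^sub>L real" and g'' :: "'a \<Rightarrow> 'a \<Rightarrow>\<^sub>L ('a \<Rightarrow>\<^sub>L real)"
  assumes g: "\<And>x. (g has_derivative g' x) (at x)"
    and g': "\<And>x. (g' has_derivative g'' x) (at x)"
    and t: "t > 0"
  shows "\<exists>\<xi> \<eta>. 0 < \<xi> \<and> \<xi> < t \<and> 0 < \<eta> \<and> \<eta> < t \<and>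
    g (x + t *\<^sub>R u + t *\<^sub>R v) - g (x + t *\<^sub>R u) - g (x + t *\<^sub>R v) + g x
      = t\<^sup>2 * g'' (x + \<xi> *\<^sub>R u + \<eta> *\<^sub>R v) v u"
proof -
  define \<phi> where "\<phi> s = g (x + s *\<^sub>R u + t *\<^sub>R v) - g (x + s *\<^sub>R u)" for s
  have d\<phi>: "(\<phi> has_derivative (\<lambda>h. h * (g' (x + s *\<^sub>R u + t *\<^sub>R v) u - g' (x + s *\<^sub>R u) u))) (at s)" for s
    unfolding \<phi>_def
    by (auto intro!: derivative_eq_intros has_derivative_compose[OF _ g]
        simp: blinfun.scaleR_right algebra_simps)
  obtain \<xi> where \<xi>: "0 < \<xi>" "\<xi> < t"
    "\<phi> t - \<phi> 0 = (t - 0) * (g' (x + \<xi> *\<^sub>R u + t *\<^sub>R v) u - g' (x + \<xi> *\<^sub>R u) u)"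
    using mvt[of 0 t \<phi>, OF t has_derivative_continuous_on[OF has_derivative_at_withinI[OF d\<phi>]] d\<phi>] by auto
  define \<psi> where "\<psi> r = g' (x + \<xi> *\<^sub>R u + r *\<^sub>R v) u" for r
  have d\<psi>: "(\<psi> has_derivative (\<lambda>h. h * g'' (x + \<xi> *\<^sub>R u + r *\<^sub>R v) v u)) (at r)" for r
    unfolding \<psi>_def
    by (auto intro!: derivative_eq_intros has_derivative_compose[OF _ g']
        simp: blinfun.scaleR_right blinfun.scaleR_left algebra_simps)
  obtain \<eta> where \<eta>: "0 < \<eta>" "\<eta> < t"
    "\<psi> t - \<psi> 0 = (t - 0) * g'' (x + \<xi> *\<^sub>R u + \<eta> *\<^sub>R v) v u"
    using mvt[of 0 t \<psi>, OF t has_derivative_continuous_on[OF has_derivative_at_withinI[OF d\<psi>]] d\<psi>] by auto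
  have "g (x + t *\<^sub>R u + t *\<^sub>R v) - g (x + t *\<^sub>R u) - g (x + t *\<^sub>R v) + g x = \<phi> t - \<phi> 0"
    by (simp add: \<phi>_def)
  also have "\<dots> = t * (\<psi> t - \<psi> 0)" using \<xi> by (simp add: \<psi>_def)
  also have "\<dots> = t\<^sup>2 * g'' (x + \<xi> *\<^sub>R u + \<eta> *\<^sub>R v) v u" using \<eta>(3) by (simp add: power2_eq_square)
  finally show ?thesis using \<xi>(1,2) \<eta>(1,2) by blast
qed

text \<open>The second difference does not change when \<open>u\<close> and \<open>v\<close> are
  exchanged. Divided by the squared step it therefore tends to both mixed values.\<close>

lemma second_derivative_symmetric:
  fixes g :: "'a::real_normed_vector \<Rightarrow> real"
    and g' :: "'a \<Rightarrow> 'a \<Rightarrow>\<^sub>L real" and g'' :: "'a \<Rightarrow> 'a \<Rightarrow>\<^sub>L ('a \<Rightarrow>\<^sub>L real)"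
  assumes g: "\<And>x. (g has_derivative g' x) (at x)"
    and g': "\<And>x. (g' has_derivative g'' x) (at x)"
    and cont: "continuous (at x) g''"
  shows "g'' x u v = g'' x v u"
proof -
  define \<tau> where "\<tau> n = inverse (real (Suc n))" for n
  have \<tau>: "\<tau> n > 0" for n by (simp add: \<tau>_def)
  \<comment> \<open>The directions are generalized here since the second use exchanges them.\<close>
  have lim: "(\<lambda>n. g'' (x + a n *\<^sub>R u + b n *\<^sub>R v) r s) \<longlonglongrightarrow> g'' x r s"
    if "\<And>n. 0 < a n \<and> a n < \<tau> n" "\<And>n. 0 < b n \<and> b n < \<tau> n" for a b u v r s
  proof -
    have "a \<longlonglongrightarrow> 0" "b \<longlonglongrightarrow> 0"
      using that by (auto intro!: real_tendsto_sandwich[OF _ _ tendsto_const LIMSEQ_inverse_real_of_nat]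
          always_eventually simp: \<tau>_def less_imp_le)
    then have "(\<lambda>n. x + a n *\<^sub>R u + b n *\<^sub>R v) \<longlonglongrightarrow> x + 0 *\<^sub>R u + 0 *\<^sub>R v"
      by (intro tendsto_intros)
    then have "(\<lambda>n. g'' (x + a n *\<^sub>R u + b n *\<^sub>R v)) \<longlonglongrightarrow> g'' x"
      using isCont_tendsto_compose[OF cont] by simp
    then show ?thesis by (intro blinfun.tendsto tendsto_const)
  qed
  define \<Delta> where "\<Delta> n = (g (x + \<tau> n *\<^sub>R u + \<tau> n *\<^sub>R v) - g (x + \<tau> n *\<^sub>R u) - g (x + \<tau> n *\<^sub>R v) + g x) / (\<tau> n)\<^sup>2" for n
  obtain a b where ab: "\<And>n. 0 < a n \<and> a n < \<tau> n" "\<And>n. 0 < b n \<and> b n < \<tau> n"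
    "\<And>n. \<Delta> n = g'' (x + a n *\<^sub>R u + b n *\<^sub>R v) v u"
    using second_difference_mean_value[of g g' g'' "\<tau> _" x u v, OF g g' \<tau>] \<tau>
    unfolding \<Delta>_def by (simp add: less_imp_neq[symmetric] field_simps) metis
  obtain c d where cd: "\<And>n. 0 < c n \<and> c n < \<tau> n" "\<And>n. 0 < d n \<and> d n < \<tau> n"
    "\<And>n. \<Delta> n = g'' (x + c n *\<^sub>R v + d n *\<^sub>R u) u v"
    using second_difference_mean_value[of g g' g'' "\<tau> _" x v u, OF g g' \<tau>] \<tau>
    unfolding \<Delta>_def by (simp add: less_imp_neq[symmetric] field_simps) metis
  have "\<Delta> \<longlonglongrightarrow> g'' x v u" unfolding ab(3) by (rule lim[OF ab(1,2)])
  moreover have "\<Delta> \<longlonglongrightarrow> g'' x u v" unfolding cd(3) by (rule lim[OF cd(1,2)])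
  ultimately show ?thesis by (metis LIMSEQ_unique)
qed

section \<open>Positive definiteness of the augmented Hessian\<close>

text \<open>The library simp rule turns \<open>transpose A *v x\<close> into \<open>x v* A\<close>, which hides the adjoint.\<close>
declare transpose_matrix_vector [simp del]

section \<open>Quadratic forms and smallest eigenvalues\<close>

lemma symmetric_inner_matrix:
  fixes A :: "real^'n^'n"
  assumes "transpose A = A"
  shows "u \<bullet> (A *v v) = (A *v u) \<bullet> v"
  by (metis assms dot_lmul_matrix vector_transpose_matrix)

lemma inner_transpose_mult:
  fixes A :: "real^'n^'m"
  shows "(transpose A *v w) \<bullet> v = w \<bullet> (A *v v)"
  by (simp add: dot_lmul_matrix flip: vector_transpose_matrix)

text \<open>Compactness of the unit sphere, then homogeneity of degree two. The minimizer yields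
  both the smallest eigenvalue of a symmetric matrix and the coercivity constant of a positive
  form.\<close>

lemma rayleigh_quotient_attains_min:
  fixes A :: "real^'n^'n"
  obtains v0 where "norm v0 = 1" "\<And>v. v0 \<bullet> (A *v v0) * (norm v)\<^sup>2 \<le> v \<bullet> (A *v v)"
proof -
  let ?q = "\<lambda>v. v \<bullet> (A *v v)"
  have "continuous_on (sphere 0 1) ?q"
    by (intro continuous_intros matrix_vector_mult_linear_continuous_on)
  moreover have "sphere 0 1 \<noteq> ({} :: (real^'n) set)" by simp
  ultimately obtain v0 where v0: "v0 \<in> sphere 0 1" "\<forall>v\<in>sphere 0 1. ?q v0 \<le> ?q v"
    using continuous_attains_inf[OF compact_sphere, of 0 1 ?q] by blast
  have "?q v0 * (norm v)\<^sup>2 \<le> ?q v" for v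
  proof (cases "v = 0")
    case False
    then have "(1 / norm v) *\<^sub>R v \<in> sphere 0 1" by simp
    then have "?q v0 \<le> ?q ((1 / norm v) *\<^sub>R v)" using v0(2) by blast
    also have "\<dots> = ?q v / (norm v)\<^sup>2"
      by (simp add: matrix_vector_mult_scaleR power2_eq_square)
    finally show ?thesis using False by (simp add: field_simps)
  qed auto
  with v0(1) show thesis by (intro that) auto
qed

text \<open>A minimizer \<open>v0\<close> of the Rayleigh quotient is an eigenvector: if the
  residual \<open>w = A v0 - m v0\<close> were nonzero, a small step from \<open>v0\<close> along
  \<open>- w\<close> would push the form below its minimum. Every eigenvalue is a value of the
  quotient, so \<open>m\<close> is the least one and the \<open>LEAST\<close> in the definition is
  attained.\<close>

lemma lambda_min_eigenvalue:
  fixes A :: "real^'n^'n"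
  assumes sym: "transpose A = A"
  shows "\<exists>v. v \<noteq> 0 \<and> A *v v = lambda_min A *\<^sub>R v"
    and "lambda_min A * (norm v)\<^sup>2 \<le> v \<bullet> (A *v v)"
proof -
  let ?q = "\<lambda>v. v \<bullet> (A *v v)"
  obtain v0 where v0: "norm v0 = 1" "\<And>v. ?q v0 * (norm v)\<^sup>2 \<le> ?q v"
    using rayleigh_quotient_attains_min[of A] by blast
  define m where "m = ?q v0"
  have min: "m * (norm v)\<^sup>2 \<le> ?q v" for v using v0(2) by (simp add: m_def)
  have "A *v v0 = m *\<^sub>R v0"
  proof -
    define w where "w = A *v v0 - m *\<^sub>R v0"
    define a where "a = ?q w - m * (norm w)\<^sup>2"
    have a: "a \<ge> 0" using min[of w] by (simp add: a_def)
    have quad: "0 \<le> 2 * t * (norm w)\<^sup>2 + t\<^sup>2 * a" for t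
    proof -
      have "(A *v v0) \<bullet> w = v0 \<bullet> (A *v w)" using symmetric_inner_matrix[OF sym] by simp
      moreover have "v0 \<bullet> v0 = 1" using v0 by (simp add: norm_eq_1)
      moreover have "?q v0 = m" by (simp add: m_def)
      ultimately have "?q (v0 + t *\<^sub>R w) - m * (norm (v0 + t *\<^sub>R w))\<^sup>2
          = 2 * t * (w \<bullet> (A *v v0 - m *\<^sub>R v0)) + t\<^sup>2 * a"
        unfolding power2_norm_eq_inner a_def
        by (simp add: matrix_vector_right_distrib matrix_vector_mult_scaleR inner_commute
          algebra_simps power2_eq_square)
      then show ?thesis using min[of "v0 + t *\<^sub>R w"] by (simp add: power2_norm_eq_inner flip: w_def)
    qed
    have "(norm w)\<^sup>2 = 0"
    proof (rule ccontr)
      assume "(norm w)\<^sup>2 \<noteq> 0"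
      then have p: "(norm w)\<^sup>2 > 0" by simp
      \<comment> \<open>Small enough that the quadratic term cannot compensate the linear one;
        \<open>a + 1\<close> avoids dividing by zero.\<close>
      define t where "t = - ((norm w)\<^sup>2 / (a + 1))"
      have "t * (2 * (norm w)\<^sup>2 + t * a) \<ge> 0" using quad[of t] by (simp add: algebra_simps power2_eq_square)
      moreover have "t < 0" using p a by (simp add: t_def)
      ultimately have "2 * (norm w)\<^sup>2 + t * a \<le> 0" by (simp add: zero_le_mult_iff)
      moreover have "- t * a \<le> (norm w)\<^sup>2" using p a by (simp add: t_def field_simps)
      ultimately show False using p by simp
    qed
    then show ?thesis by (simp add: w_def)
  qed
  then have ev: "\<exists>v. v \<noteq> 0 \<and> A *v v = m *\<^sub>R v" using v0 by (metis norm_zero zero_neq_one)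
  have "lambda_min A = m" unfolding lambda_min_def
  proof (rule Least_equality)
    show "\<exists>v. v \<noteq> 0 \<and> A *v v = m *\<^sub>R v" by (rule ev)
    fix c assume "\<exists>v. v \<noteq> 0 \<and> A *v v = c *\<^sub>R v"
    then obtain v where v: "v \<noteq> 0" "A *v v = c *\<^sub>R v" by blast
    then show "m \<le> c" using min[of v] by (simp add: power2_norm_eq_inner)
  qed
  with ev min show "\<exists>v. v \<noteq> 0 \<and> A *v v = lambda_min A *\<^sub>R v"
    "lambda_min A * (norm v)\<^sup>2 \<le> v \<bullet> (A *v v)" by auto
qed

section \<open>Matrices of full row rank\<close>

context
  fixes A :: "real^'n^'p"
  assumes full_rank: "rank A = CARD('p)"
begin

lemma inj_transpose_full_rank: "inj ((*v) (transpose A))"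
  using full_rank full_rank_injective[of "transpose A"] by (simp add: rank_transpose)

lemma gram_inner: "w \<bullet> ((A ** transpose A) *v w) = (norm (transpose A *v w))\<^sup>2"
  by (simp add: power2_norm_eq_inner inner_transpose_mult flip: matrix_vector_mul_assoc)

lemma gram_symmetric: "transpose (A ** transpose A) = A ** transpose A"
  by (simp add: matrix_transpose_mul)

text \<open>The form of the Gram matrix is \<open>(norm (transpose A *v w))^2\<close>, which is
  positive for nonzero \<open>w\<close> by injectivity. Positivity of the eigenvalue is also what
  lets the square undo the \<open>sqrt\<close> in \<open>sigma_min\<close>.\<close>

lemma sigma_min_sq_full_rank:
  shows "(sigma_min A)\<^sup>2 > 0" and "(sigma_min A)\<^sup>2 * (norm w)\<^sup>2 \<le> (norm (transpose A *v w))\<^sup>2"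
proof -
  obtain v where v: "v \<noteq> 0" "(A ** transpose A) *v v = lambda_min (A ** transpose A) *\<^sub>R v"
    using lambda_min_eigenvalue(1)[OF gram_symmetric] by blast
  have "transpose A *v v \<noteq> 0"
    using injD[OF inj_transpose_full_rank, of v 0] v(1) by auto
  then have "lambda_min (A ** transpose A) * (v \<bullet> v) > 0"
    using gram_inner[of v] v(2) by simp
  then have pos: "lambda_min (A ** transpose A) > 0" by (metis inner_ge_zero not_less zero_less_mult_iff)
  then show "(sigma_min A)\<^sup>2 > 0" by (simp add: sigma_min_def)
  show "(sigma_min A)\<^sup>2 * (norm w)\<^sup>2 \<le> (norm (transpose A *v w))\<^sup>2"
    using lambda_min_eigenvalue(2)[OF gram_symmetric, of w] gram_inner[of w] pos
    by (simp add: sigma_min_def)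
qed

text \<open>With \<open>b\<close> the image of \<open>w\<close> under the transpose,
  \<open>(norm b)^2 = w \<bullet> (A *v b)\<close> is at most \<open>norm w * norm (A *v b)\<close>.
  Multiplying this with itself and using the lower bound for the transpose leaves a factor
  \<open>(norm w)^2\<close> to cancel.\<close>

lemma sigma_min_le_on_row_space:
  "(sigma_min A)\<^sup>2 * (norm (transpose A *v w))\<^sup>2 \<le> (norm (A *v (transpose A *v w)))\<^sup>2"
proof (cases "w = 0")
  case False
  let ?s = "(sigma_min A)\<^sup>2" and ?b = "transpose A *v w"
  define q where "q = (norm ?b)\<^sup>2"
  have q0: "q \<ge> 0" by (simp add: q_def)
  have q: "q = w \<bullet> (A *v ?b)" by (simp add: q_def power2_norm_eq_inner inner_transpose_mult)
  have "(?s * q) * (norm w)\<^sup>2 = (?s * (norm w)\<^sup>2) * q" by simp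
  also have "\<dots> \<le> q * q" unfolding q_def using sigma_min_sq_full_rank(2) by (intro mult_right_mono) auto
  also have "\<dots> \<le> (norm w * norm (A *v ?b)) * (norm w * norm (A *v ?b))"
    using Cauchy_Schwarz_ineq2[of w "A *v ?b"] q q0 by (intro mult_mono) auto
  also have "\<dots> = (norm (A *v ?b))\<^sup>2 * (norm w)\<^sup>2" by (simp add: power2_eq_square)
  finally show ?thesis using False by (simp add: q_def)
qed simp

text \<open>The row space part solves the normal equation for \<open>w\<close>, which is possible
  because the Gram matrix is injective and hence surjective.\<close>

lemma kernel_row_space_decomposition:
  obtains a w where "v = a + transpose A *v w" "A *v a = 0"
proof -
  have "inj ((*v) (A ** transpose A))"
  proof (subst linear_injective_0)
    show "\<forall>w. (A ** transpose A) *v w = 0 \<longrightarrow> w = 0"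
    proof (intro allI impI)
      fix w assume "(A ** transpose A) *v w = 0"
      then have "transpose A *v w = 0" using gram_inner[of w] by simp
      then show "w = 0" using injD[OF inj_transpose_full_rank, of w 0] by simp
    qed
  qed simp
  then have "surj ((*v) (A ** transpose A))" by (simp add: linear_injective_imp_surjective)
  then obtain w where "(A ** transpose A) *v w = A *v v" by (metis surjD)
  then show ?thesis
    by (intro that[of "v - transpose A *v w" w]) (simp_all add: matrix_vector_mult_diff_distrib flip: matrix_vector_mul_assoc)
qed

text \<open>\<open>l\<close> bounds \<open>H\<close> on the kernel, \<open>q\<close> bounds the
  augmented form on the row space, and the spectral norm bounds the two mixed terms. A real
  \<open>l\<close> stands in for the extended real \<open>lambda_sosc\<close>, so that a trivial
  kernel is covered by a suitable finite choice.\<close>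

lemma augmented_hessian_pos:
  fixes H :: "real^'n^'n"
  assumes sym: "transpose H = H" and l: "l > 0" "\<And>v. A *v v = 0 \<Longrightarrow> l * (norm v)\<^sup>2 \<le> v \<bullet> (H *v v)"
    and k: "k \<ge> 0" "2 * (spectral_norm H)\<^sup>2 / l < lambda_min H + k * (sigma_min A)\<^sup>2"
    and v: "v \<noteq> 0"
  shows "v \<bullet> (H *v v) + k * (norm (A *v v))\<^sup>2 > 0"
proof -
  obtain a w where aw: "v = a + transpose A *v w" "A *v a = 0"
    using kernel_row_space_decomposition by blast
  define b where "b = transpose A *v w"
  define N where "N = spectral_norm H"
  define q where "q = lambda_min H + k * (sigma_min A)\<^sup>2"
  have N: "\<bar>x \<bullet> (H *v y)\<bar> \<le> N * (norm x * norm y)" for x y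
  proof -
    have "\<bar>x \<bullet> (H *v y)\<bar> \<le> norm x * norm (H *v y)" by (rule Cauchy_Schwarz_ineq2)
    also have "\<dots> \<le> norm x * (N * norm y)"
      unfolding N_def spectral_norm_def by (intro mult_left_mono onorm) auto
    finally show ?thesis by (simp add: algebra_simps)
  qed
  define S where "S = l * (norm a)\<^sup>2 - 2 * N * (norm a * norm b) + q * (norm b)\<^sup>2"
  have "v \<bullet> (H *v v) = a \<bullet> (H *v a) + a \<bullet> (H *v b) + b \<bullet> (H *v a) + b \<bullet> (H *v b)"
    by (simp add: aw(1) matrix_vector_right_distrib inner_add_left inner_add_right flip: b_def)
  moreover have "(norm (A *v v))\<^sup>2 \<ge> (sigma_min A)\<^sup>2 * (norm b)\<^sup>2"
    using sigma_min_le_on_row_space[of w] aw(2)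
    by (simp add: aw(1) matrix_vector_right_distrib b_def)
  then have "k * (norm (A *v v))\<^sup>2 \<ge> k * ((sigma_min A)\<^sup>2 * (norm b)\<^sup>2)"
    using k(1) by (rule mult_left_mono)
  ultimately have S: "v \<bullet> (H *v v) + k * (norm (A *v v))\<^sup>2 \<ge> S"
    using l(2)[OF aw(2)] N[of a b] N[of b a] lambda_min_eigenvalue(2)[OF sym, of b]
    by (simp add: S_def q_def algebra_simps)
  \<comment> \<open>The gain condition is \<open>2 * N^2 / l < q\<close>. In the strict form chosen
    here it gives a positive difference even for \<open>N = 0\<close>.\<close>
  have lq: "l * q - N\<^sup>2 > N\<^sup>2" using k(2) l(1) by (simp add: q_def N_def field_simps)
  \<comment> \<open>Completing the square; the factor \<open>l\<close> keeps divisions out.\<close>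
  have eq: "l * S = (l * norm a - N * norm b)\<^sup>2 + (l * q - N\<^sup>2) * (norm b)\<^sup>2"
    by (simp add: S_def power2_eq_square algebra_simps)
  have "l * S > 0"
  proof (cases "b = 0")
    case True
    then have "a \<noteq> 0" using v aw(1) by (simp add: b_def)
    then show ?thesis unfolding eq using True l(1) by simp
  next
    case False
    have "l * q - N\<^sup>2 > 0" using lq by (meson le_less_trans zero_le_power2)
    then show ?thesis unfolding eq using False by (intro add_nonneg_pos) auto
  qed
  then have "S > 0" using l(1) by (simp add: zero_less_mult_iff)
  with S show ?thesis by simp
qed

end

lemma quadratic_form_coercive:
  fixes B :: "real^'n^'n"
  assumes "\<And>v. v \<noteq> 0 \<Longrightarrow> v \<bullet> (B *v v) > 0"
  obtains \<beta> where "\<beta> > 0" "\<And>v. \<beta> * (norm v)\<^sup>2 \<le> v \<bullet> (B *v v)"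
proof -
  obtain v0 where v0: "norm v0 = 1" "\<And>v. v0 \<bullet> (B *v v0) * (norm v)\<^sup>2 \<le> v \<bullet> (B *v v)"
    using rayleigh_quotient_attains_min[of B] by blast
  then have "v0 \<noteq> 0" by auto
  with v0(2) assms show thesis by (intro that[of "v0 \<bullet> (B *v v0)"]) auto
qed

section \<open>Regularity of the field\<close>

lemma bounded_linear_vec_lambda:
  assumes "\<And>i. bounded_linear (f i)"
  shows "bounded_linear (\<lambda>x. \<chi> i::'n::finite. f i x)"
proof -
  have lin: "f i (x + y) = f i x + f i y" "f i (r *\<^sub>R x) = r *\<^sub>R f i x" for i x y r
    using assms[of i] by (simp_all add: linear_simps)
  obtain K where K: "\<And>i x. norm (f i x) \<le> norm x * K i"
    using bounded_linear.bounded[OF assms] by metis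
  show ?thesis
  proof (rule bounded_linear_intro[where K="\<Sum>i\<in>UNIV. K i"])
    fix x
    have "norm (\<chi> i. f i x) \<le> (\<Sum>i\<in>UNIV. norm (f i x))"
      unfolding norm_vec_def by (simp add: L2_set_le_sum)
    also have "\<dots> \<le> (\<Sum>i\<in>UNIV. norm x * K i)" by (intro sum_mono K)
    finally show "norm (\<chi> i. f i x) \<le> norm x * (\<Sum>i\<in>UNIV. K i)"
      by (simp add: sum_distrib_left)
  qed (simp_all add: vec_eq_iff lin)
qed

lemma bounded_bilinear_matrix_vector_mult:
  "bounded_bilinear (\<lambda>(A :: real^'n^'m) v. A *v v)"
  by (simp flip: bilinear_conv_bounded_bilinear)
     (auto simp: bilinear_def matrix_vector_mult_add_rdistrib matrix_vector_right_distrib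
        matrix_vector_mult_scaleR scaleR_matrix_vector_assoc intro!: linearI)

lemma bounded_bilinear_matrix_mult:
  "bounded_bilinear (\<lambda>(A :: real^'n^'m) (B :: real^'k^'n). A ** B)"
  by (simp flip: bilinear_conv_bounded_bilinear)
     (auto simp: bilinear_def matrix_matrix_mult_def vec_eq_iff sum.distrib algebra_simps
        sum_distrib_left intro!: linearI)

lemma bounded_linear_transpose:
  "bounded_linear (transpose :: real^'n^'m \<Rightarrow> real^'m^'n)"
  unfolding transpose_def
  by (intro bounded_linear_vec_lambda bounded_linear_compose[OF bounded_linear_vec_nth] bounded_linear_vec_nth)

text \<open>A regularity class closed under sums, bounded linear images and bilinear products, so
  that the field can be treated without computing its derivative everywhere. It supplies what is
  used later: Lipschitz bounds on balls and a derivative at the equilibrium.\<close>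

definition smooth_lip :: "('a::real_normed_vector \<Rightarrow> 'b::real_normed_vector) \<Rightarrow> bool" where
  "smooth_lip g \<longleftrightarrow> (\<forall>x. g differentiable (at x)) \<and> (\<forall>R. \<exists>L. L-lipschitz_on (cball 0 R) g)"

text \<open>The derivative is bounded on the compact ball, and the ball is convex, so the mean value
  inequality applies.\<close>

lemma C1_smooth_lip:
  fixes g :: "'a::euclidean_space \<Rightarrow> 'b::real_normed_vector"
  assumes der: "\<And>x. (g has_derivative blinfun_apply (g' x)) (at x)" and cont: "continuous_on UNIV g'"
  shows "smooth_lip g"
  unfolding smooth_lip_def
proof (intro conjI allI)
  show "g differentiable (at x)" for x using der unfolding differentiable_def by blast
  fix R
  have "bounded (g' ` cball 0 R)"
    using cont by (intro compact_imp_bounded compact_continuous_image) (auto elim: continuous_on_subset)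
  then obtain L where L: "L > 0" "\<forall>y \<in> g' ` cball 0 R. norm y \<le> L"
    by (meson bounded_pos)
  have "L-lipschitz_on (cball 0 R) g"
  proof (rule lipschitz_onI)
    fix x y :: 'a assume xy: "x \<in> cball 0 R" "y \<in> cball 0 R"
    show "dist (g x) (g y) \<le> L * dist x y"
      unfolding dist_norm
    proof (rule differentiable_bound[OF convex_cball _ _ xy])
      fix z :: 'a assume z: "z \<in> cball 0 R"
      show "(g has_derivative blinfun_apply (g' z)) (at z within cball 0 R)"
        by (rule has_derivative_at_withinI[OF der])
      show "onorm (blinfun_apply (g' z)) \<le> L"
        using L(2) z unfolding norm_blinfun.rep_eq by blast
    qed
  qed (use L(1) in simp)
  then show "\<exists>L. L-lipschitz_on (cball 0 R) g" ..
qed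

lemma smooth_lip_const: "smooth_lip (\<lambda>_. c)"
  unfolding smooth_lip_def using lipschitz_on_constant by (auto intro!: exI[of _ 0])

lemma smooth_lip_linear:
  assumes "bounded_linear l" "smooth_lip g"
  shows "smooth_lip (\<lambda>x. l (g x))"
proof -
  obtain K where K: "K-lipschitz_on UNIV l" using bounded_linear.lipschitz_boundE[OF assms(1)] .
  then have "(K * L)-lipschitz_on S (\<lambda>x. l (g x))" if "L-lipschitz_on S g" for L S
    using lipschitz_on_compose[OF that, of K l] lipschitz_on_subset[of K UNIV l] by (auto simp: o_def)
  moreover have "(\<lambda>x. l (g x)) differentiable (at x)" for x
    using assms bounded_linear_imp_differentiable[OF assms(1)] differentiable_chain_at[of g x l]
    by (auto simp: smooth_lip_def o_def)
  ultimately show ?thesis using assms(2) unfolding smooth_lip_def by blast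
qed

lemma smooth_lip_add:
  assumes "smooth_lip g" "smooth_lip k"
  shows "smooth_lip (\<lambda>x. g x + k x)"
  unfolding smooth_lip_def
proof (intro conjI allI)
  show "(\<lambda>x. g x + k x) differentiable (at x)" for x
    using assms by (auto intro: differentiable_add simp: smooth_lip_def)
  fix R
  obtain L1 L2 where "L1-lipschitz_on (cball 0 R) g" "L2-lipschitz_on (cball 0 R) k"
    using assms unfolding smooth_lip_def by blast
  then show "\<exists>L. L-lipschitz_on (cball 0 R) (\<lambda>x. g x + k x)"
    using lipschitz_on_add by blast
qed

lemma smooth_lip_bounded:
  assumes "smooth_lip (g :: 'a::euclidean_space \<Rightarrow> 'b::real_normed_vector)"
  obtains K where "K > 0" "\<And>x. x \<in> cball 0 R \<Longrightarrow> norm (g x) \<le> K"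
proof -
  have "continuous_on (cball 0 R) g"
    using assms lipschitz_on_continuous_on unfolding smooth_lip_def by blast
  then have "bounded (g ` cball 0 R)"
    by (intro compact_imp_bounded compact_continuous_image) auto
  then obtain K where "K > 0" "\<forall>y \<in> g ` cball 0 R. norm y \<le> K"
    by (meson bounded_pos)
  then show thesis by (intro that[of K]) auto
qed

lemma smooth_lip_bilinear:
  fixes g :: "'a::euclidean_space \<Rightarrow> 'b::real_normed_vector" and k :: "'a \<Rightarrow> 'c::real_normed_vector"
  assumes b: "bounded_bilinear b" and g: "smooth_lip g" and k: "smooth_lip k"
  shows "smooth_lip (\<lambda>x. b (g x) (k x))"
  unfolding smooth_lip_def
proof (intro conjI allI)
  interpret bounded_bilinear b by fact
  show "(\<lambda>x. b (g x) (k x)) differentiable (at x)" for x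
    using g k FDERIV[of g _ x UNIV k] unfolding smooth_lip_def differentiable_def by blast
  fix R
  obtain Kb where Kb: "Kb > 0" "\<And>u v. norm (b u v) \<le> norm u * norm v * Kb" using pos_bounded by blast
  obtain Kg where Kg: "Kg > 0" "\<And>x. x \<in> cball 0 R \<Longrightarrow> norm (g x) \<le> Kg" using smooth_lip_bounded[OF g, where R=R] by blast
  obtain Kk where Kk: "Kk > 0" "\<And>x. x \<in> cball 0 R \<Longrightarrow> norm (k x) \<le> Kk" using smooth_lip_bounded[OF k, where R=R] by blast
  obtain Lg where Lg: "Lg-lipschitz_on (cball 0 R) g" using g unfolding smooth_lip_def by blast
  obtain Lk where Lk: "Lk-lipschitz_on (cball 0 R) k" using k unfolding smooth_lip_def by blast
  have L0: "Lg \<ge> 0" "Lk \<ge> 0" using Lg Lk lipschitz_on_nonneg by blast+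
  have "(Lg * Kk * Kb + Kg * Lk * Kb)-lipschitz_on (cball 0 R) (\<lambda>x. b (g x) (k x))"
  proof (rule lipschitz_onI)
    fix x y :: 'a assume xy: "x \<in> cball 0 R" "y \<in> cball 0 R"
    have "b (g x) (k x) - b (g y) (k y) = b (g x - g y) (k x) + b (g y) (k x - k y)"
      by (simp add: diff_left diff_right)
    also have "norm \<dots> \<le> norm (g x - g y) * norm (k x) * Kb + norm (g y) * norm (k x - k y) * Kb"
      by (intro order_trans[OF norm_triangle_ineq] add_mono Kb)
    also have "\<dots> \<le> (Lg * norm (x - y)) * Kk * Kb + Kg * (Lk * norm (x - y)) * Kb"
      using Kb Kg Kk xy L0 lipschitz_on_normD[OF Lg xy] lipschitz_on_normD[OF Lk xy]
      by (intro add_mono mult_mono) auto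
    finally show "dist (b (g x) (k x)) (b (g y) (k y)) \<le> (Lg * Kk * Kb + Kg * Lk * Kb) * dist x y"
      by (simp add: dist_norm algebra_simps)
  qed (use Kb Kg Kk L0 in auto)
  then show "\<exists>L. L-lipschitz_on (cball 0 R) (\<lambda>x. b (g x) (k x))" ..
qed

lemma smooth_lip_fst:
  fixes g :: "'a::real_normed_vector \<Rightarrow> 'b::real_normed_vector"
  assumes "smooth_lip g"
  shows "smooth_lip (\<lambda>z :: 'a \<times> 'c::real_normed_vector. g (fst z))"
  unfolding smooth_lip_def
proof (intro conjI allI)
  show "(\<lambda>z. g (fst z)) differentiable (at z)" for z :: "'a \<times> 'c"
    using assms differentiable_chain_at[of fst z g]
      bounded_linear_imp_differentiable[OF bounded_linear_fst]
    by (auto simp: smooth_lip_def o_def)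
  fix R
  obtain L where "L-lipschitz_on (cball 0 R) g" using assms unfolding smooth_lip_def by blast
  moreover have "fst ` cball (0 :: 'a \<times> 'c) R \<subseteq> cball 0 R"
    using order_trans[OF dist_fst_le[of "0 :: 'a \<times> 'c"]] by force
  moreover have "1-lipschitz_on (cball (0 :: 'a \<times> 'c) R) fst"
    by (intro lipschitz_onI) (auto simp: dist_fst_le)
  ultimately have "(L * 1)-lipschitz_on (cball (0 :: 'a \<times> 'c) R) (g \<circ> fst)"
    by (blast intro: lipschitz_on_compose lipschitz_on_subset)
  then show "\<exists>L. L-lipschitz_on (cball 0 R) (\<lambda>z :: 'a \<times> 'c. g (fst z))" by (auto simp: o_def)
qed

lemma smooth_lip_snd: "smooth_lip (snd :: 'a::real_normed_vector \<times> 'b::real_normed_vector \<Rightarrow> 'b)"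
  unfolding smooth_lip_def
proof (intro conjI allI)
  show "\<exists>L. L-lipschitz_on (cball 0 R) (snd :: 'a \<times> 'b \<Rightarrow> 'b)" for R
    by (intro exI[of _ 1] lipschitz_onI) (simp_all add: dist_snd_le)
qed (intro bounded_linear_imp_differentiable bounded_linear_snd)

section \<open>Gradients, Jacobians and Hessians of C2 functions\<close>

lemma C2_E:
  assumes "C2 g"
  obtains g' g'' where "\<And>x. (g has_derivative blinfun_apply (g' x)) (at x)"
     "\<And>x. (g' has_derivative blinfun_apply (g'' x)) (at x)"
     "continuous_on UNIV g''"
  using assms unfolding C2_def by blast

lemma C2_smooth_lip:
  fixes g :: "'a::euclidean_space \<Rightarrow> 'b::real_normed_vector"
  assumes "C2 g" shows "smooth_lip g"
proof -
  obtain g' g'' where g: "\<And>x. (g has_derivative blinfun_apply (g' x)) (at x)"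
     "\<And>x. (g' has_derivative blinfun_apply (g'' x)) (at x)" using C2_E[OF assms] by metis
  have "continuous_on UNIV g'"
    using has_derivative_continuous[OF g(2)] by (simp add: continuous_at_imp_continuous_on)
  with g(1) show ?thesis by (rule C1_smooth_lip)
qed

lemma gradient_eq:
  assumes "(g has_derivative blinfun_apply g') (at x)"
  shows "gradient g x = (\<chi> i. g' (axis i 1))"
  unfolding gradient_def frechet_derivative_at[OF assms, symmetric] ..

lemma jacobian_eq:
  assumes "(g has_derivative blinfun_apply g') (at x)"
  shows "jacobian g (at x) = (\<chi> i j. g' (axis j 1) $ i)"
  unfolding jacobian_def frechet_derivative_at[OF assms, symmetric] matrix_def ..

lemma C2_smooth_lip_gradient:
  assumes "C2 g" shows "smooth_lip (gradient g)"
proof -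
  obtain g' g'' where g: "\<And>x. (g has_derivative blinfun_apply (g' x)) (at x)"
     "\<And>x. (g' has_derivative blinfun_apply (g'' x)) (at x)" "continuous_on UNIV g''" using C2_E[OF assms] by metis
  have "gradient g = (\<lambda>x. \<chi> i. g' x (axis i 1))" using gradient_eq[OF g(1)] by blast
  moreover have "smooth_lip g'" using g(2,3) by (rule C1_smooth_lip)
  ultimately show ?thesis
    using smooth_lip_linear[OF bounded_linear_vec_lambda[OF blinfun.bounded_linear_left]] by simp
qed

lemma C2_smooth_lip_jacobian:
  fixes g :: "real^'n \<Rightarrow> real^'m"
  assumes "C2 g" shows "smooth_lip (\<lambda>x. jacobian g (at x))"
proof -
  obtain g' g'' where g: "\<And>x. (g has_derivative blinfun_apply (g' x)) (at x)"
     "\<And>x. (g' has_derivative blinfun_apply (g'' x)) (at x)" "continuous_on UNIV g''" using C2_E[OF assms] by metis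
  have "(\<lambda>x. jacobian g (at x)) = (\<lambda>x. \<chi> i j. g' x (axis j 1) $ i)" using jacobian_eq[OF g(1)] by blast
  moreover have "smooth_lip g'" using g(2,3) by (rule C1_smooth_lip)
  moreover have "bounded_linear (\<lambda>l :: (real^'n) \<Rightarrow>\<^sub>L (real^'m). \<chi> i j. l (axis j 1) $ i)"
    by (intro bounded_linear_vec_lambda bounded_linear_compose[OF bounded_linear_vec_nth]
        blinfun.bounded_linear_left)
  ultimately show ?thesis using smooth_lip_linear by fastforce
qed

text \<open>This identifies the Hessian matrix with the second derivative as a bilinear form and
  thereby carries symmetry from one to the other. The first argument of \<open>g''\<close> is the
  direction in which the gradient is differentiated.\<close>

lemma hessian_inner:
  assumes g: "\<And>x. (g has_derivative blinfun_apply (g' x)) (at x)"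
    and g': "(g' has_derivative blinfun_apply g'') (at x)"
  shows "u \<bullet> (hessian g x *v v) = g'' v u"
proof -
  have "((\<lambda>y. \<chi> i. g' y (axis i 1)) has_derivative (\<lambda>v. \<chi> i. g'' v (axis i 1))) (at x)"
    by (rule bounded_linear.has_derivative[OF bounded_linear_vec_lambda[OF blinfun.bounded_linear_left] g'])
  moreover have "gradient g = (\<lambda>y. \<chi> i. g' y (axis i 1))" using gradient_eq[OF g] by blast
  ultimately have d: "(gradient g has_derivative (\<lambda>v. \<chi> i. g'' v (axis i 1))) (at x)" by simp
  then have "(gradient g has_derivative (\<lambda>v. hessian g x *v v)) (at x)"
    unfolding hessian_def using jacobian_works differentiableI by blast
  with d have "hessian g x *v v = (\<chi> i. g'' v (axis i 1))"
    using has_derivative_unique by metis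
  then have "u \<bullet> (hessian g x *v v) = (\<Sum>i\<in>UNIV. u $ i * g'' v (axis i 1))"
    by (simp add: inner_vec_def)
  also have "\<dots> = g'' v (\<Sum>i\<in>UNIV. u $ i *\<^sub>R axis i 1)"
    by (simp add: blinfun.sum_right blinfun.scaleR_right)
  also have "(\<Sum>i\<in>UNIV. u $ i *\<^sub>R axis i 1) = u"
    using basis_expansion[of u] by (simp add: scalar_mult_eq_scaleR)
  finally show ?thesis .
qed

lemma hessian_symmetric:
  assumes "C2 g" shows "transpose (hessian g x) = hessian g x"
proof -
  obtain g' g'' where g: "\<And>x. (g has_derivative blinfun_apply (g' x)) (at x)"
     "\<And>x. (g' has_derivative blinfun_apply (g'' x)) (at x)" "continuous_on UNIV g''" using C2_E[OF assms] by metis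
  have "(transpose (hessian g x) *v u) \<bullet> v = (hessian g x *v u) \<bullet> v" for u v
  proof -
    have "(transpose (hessian g x) *v u) \<bullet> v = g'' x v u"
      unfolding inner_transpose_mult by (rule hessian_inner[OF g(1) g(2)])
    also have "\<dots> = g'' x u v"
      using g by (intro second_derivative_symmetric) (auto simp: continuous_on_eq_continuous_at)
    also have "\<dots> = (hessian g x *v u) \<bullet> v"
      by (subst inner_commute) (rule hessian_inner[OF g(1) g(2), symmetric])
    finally show ?thesis .
  qed
  then have "transpose (hessian g x) *v u = hessian g x *v u" for u
    using vector_eq_rdot by blast
  then show ?thesis unfolding matrix_eq by blast
qed

lemma C2_lagrangian:
  fixes f :: "real^'n \<Rightarrow> real" and h :: "real^'n \<Rightarrow> real^'p"
  assumes "C2 f" "C2 h" shows "C2 (\<lambda>x. lagrangian f h x \<nu>)"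
proof -
  obtain f' f'' where f: "\<And>x. (f has_derivative blinfun_apply (f' x)) (at x)"
     "\<And>x. (f' has_derivative blinfun_apply (f'' x)) (at x)" "continuous_on UNIV f''" using C2_E[OF assms(1)] by metis
  obtain h' h'' where h: "\<And>x. (h has_derivative blinfun_apply (h' x)) (at x)"
     "\<And>x. (h' has_derivative blinfun_apply (h'' x)) (at x)" "continuous_on UNIV h''" using C2_E[OF assms(2)] by metis
  define l where "l = blinfun_inner_right \<nu>"
  have bl: "bounded_linear (\<lambda>g :: (real^'n) \<Rightarrow>\<^sub>L (real^'p). l o\<^sub>L g)"
    by (rule bounded_bilinear.bounded_linear_right[OF bounded_bilinear_blinfun_compose])
  \<comment> \<open>Composition with the functional \<open>l\<close>, itself taken as a bounded
    operator on the space of derivatives; the second derivative needs it in this form.\<close>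
  define l2 where "l2 = Blinfun (\<lambda>g :: (real^'n) \<Rightarrow>\<^sub>L (real^'p). l o\<^sub>L g)"
  have l2: "blinfun_apply l2 = (\<lambda>g. l o\<^sub>L g)" unfolding l2_def using bl by (rule bounded_linear_Blinfun_apply)
  show ?thesis unfolding C2_def lagrangian_def
  proof (intro exI conjI allI)
    show "((\<lambda>x. f x + \<nu> \<bullet> h x) has_derivative blinfun_apply (f' x + (l o\<^sub>L h' x))) (at x)" for x
      by (rule has_derivative_eq_rhs[OF has_derivative_add[OF f(1) has_derivative_inner_right[OF h(1)]]])
         (simp add: fun_eq_iff blinfun.add_left l_def)
    show "((\<lambda>x. f' x + (l o\<^sub>L h' x)) has_derivative blinfun_apply (f'' x + (l2 o\<^sub>L h'' x))) (at x)" for x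
      by (rule has_derivative_eq_rhs[OF has_derivative_add[OF f(2) bounded_linear.has_derivative[OF bl h(2)]]])
         (simp add: fun_eq_iff blinfun.add_left l2)
    show "continuous_on UNIV (\<lambda>x. f'' x + (l2 o\<^sub>L h'' x))"
      by (intro continuous_intros f(3) h(3))
  qed
qed

text \<open>For a frozen multiplier the stationarity expression of the KKT conditions is a gradient,
  so its derivative in \<open>x\<close> is the Hessian of the Lagrangian.\<close>

lemma gradient_lagrangian:
  assumes "f differentiable (at x)" "h differentiable (at x)"
  shows "gradient (\<lambda>y. lagrangian f h y \<nu>) x = gradient f x + transpose (jacobian h (at x)) *v \<nu>"
proof -
  have f: "(f has_derivative frechet_derivative f (at x)) (at x)" using assms frechet_derivative_works by blast
  have h: "(h has_derivative (\<lambda>v. jacobian h (at x) *v v)) (at x)" using assms jacobian_works by blast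
  have "((\<lambda>y. f y + \<nu> \<bullet> h y) has_derivative (\<lambda>v. frechet_derivative f (at x) v + \<nu> \<bullet> (jacobian h (at x) *v v))) (at x)"
    by (intro has_derivative_add f has_derivative_inner_right h)
  note d = frechet_derivative_at[OF this, symmetric]
  show ?thesis
    unfolding gradient_def lagrangian_def d vec_eq_iff
    by (simp add: inner_axis flip: inner_transpose_mult)
qed

section \<open>The SPPID dynamics\<close>

lemma young_ineq:
  fixes a b C s :: real
  assumes "s > 0"
  shows "C * (a * b) \<le> s / 2 * b\<^sup>2 + C\<^sup>2 / (2 * s) * a\<^sup>2"
proof -
  have "0 \<le> (s * b - C * a)\<^sup>2 / (2 * s)" using assms by simp
  also have "\<dots> = s / 2 * b\<^sup>2 + C\<^sup>2 / (2 * s) * a\<^sup>2 - C * (a * b)"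
    using assms by (simp add: power2_eq_square field_simps)
  finally show ?thesis by simp
qed

lemma saddle_flow_lyapunov:
  fixes M N B :: "'a::real_inner \<Rightarrow> 'a" and J :: "'a \<Rightarrow> 'b::real_inner" and Jt :: "'b \<Rightarrow> 'a"
  assumes lin: "bounded_linear M" "bounded_linear B" "bounded_linear J" "bounded_linear Jt"
    and M: "\<And>u v. u \<bullet> M v = M u \<bullet> v" "\<And>v. (norm v)\<^sup>2 \<le> v \<bullet> M v" "\<And>v. M (N v) = v"
    and B: "\<beta> > 0" "\<And>v. \<beta> * (norm v)\<^sup>2 \<le> v \<bullet> B v"
    and J: "\<And>v w. Jt w \<bullet> v = w \<bullet> J v" "\<sigma> > 0" "\<And>w. \<sigma> * (norm w)\<^sup>2 \<le> (norm (Jt w))\<^sup>2"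
    and k: "k > 0"
  obtains P c \<gamma> where "bounded_linear P" "\<And>u v. u \<bullet> P v = P u \<bullet> v"
    "c > 0" "\<And>v. c * (norm v)\<^sup>2 \<le> v \<bullet> P v"
    "\<gamma> > 0" "\<And>e \<nu>. P (e, \<nu>) \<bullet> (- N (B e + Jt \<nu>), k *\<^sub>R J e) \<le> - \<gamma> * (norm (e, \<nu>))\<^sup>2"
proof -
  interpret M: bounded_linear M by fact
  interpret B: bounded_linear B by fact
  interpret J: bounded_linear J by fact
  interpret Jt: bounded_linear Jt by fact
  have JMl: "bounded_linear (\<lambda>e. J (M e))" and MJtl: "bounded_linear (\<lambda>w. M (Jt w))"
    using bounded_linear_compose lin by blast+
  obtain C1 where C1: "C1 > 0" "\<And>e w. \<bar>Jt w \<bullet> B e\<bar> \<le> C1 * (norm e * norm w)"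
  proof -
    obtain K1 where K1: "K1 > 0" "\<And>w. norm (Jt w) \<le> norm w * K1" using Jt.pos_bounded by blast
    obtain K2 where K2: "K2 > 0" "\<And>w. norm (B w) \<le> norm w * K2" using B.pos_bounded by blast
    have "\<bar>Jt w \<bullet> B e\<bar> \<le> K1 * K2 * (norm e * norm w)" for e w
      using order_trans[OF Cauchy_Schwarz_ineq2 mult_mono[OF K1(2) K2(2)], of w e] K1 by (simp add: mult_ac)
    then show thesis using K1 K2 by (intro that[of "K1 * K2"]) auto
  qed
  obtain C2 where C2: "C2 > 0" "\<And>e. k * (J (M e) \<bullet> J e) \<le> C2 * (norm e)\<^sup>2"
  proof -
    obtain K1 where K1: "K1 > 0" "\<And>e. norm (J (M e)) \<le> norm e * K1"
      using bounded_linear.pos_bounded[OF JMl] by blast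
    obtain K2 where K2: "K2 > 0" "\<And>e. norm (J e) \<le> norm e * K2" using J.pos_bounded by blast
    have "J (M e) \<bullet> J e \<le> K1 * K2 * (norm e)\<^sup>2" for e
      using order_trans[OF norm_cauchy_schwarz mult_mono[OF K1(2) K2(2)], of e e] K1
      by (simp add: mult_ac power2_eq_square)
    then have "k * (J (M e) \<bullet> J e) \<le> k * (K1 * K2 * (norm e)\<^sup>2)" for e
      using k by (intro mult_left_mono) auto
    then show thesis using K1 K2 k by (intro that[of "k * (K1 * K2)"]) (auto simp: mult_ac)
  qed
  obtain C3 where C3: "C3 > 0" "\<And>e w. \<bar>e \<bullet> M (Jt w)\<bar> \<le> C3 * (norm e * norm w)"
  proof -
    obtain K1 where K1: "K1 > 0" "\<And>w. norm (M (Jt w)) \<le> norm w * K1"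
      using bounded_linear.pos_bounded[OF MJtl] by blast
    have "\<bar>e \<bullet> M (Jt w)\<bar> \<le> K1 * (norm e * norm w)" for e w
      using order_trans[OF Cauchy_Schwarz_ineq2 mult_left_mono[OF K1(2)], of e w] K1 by (simp add: mult_ac)
    then show thesis using K1 by (intro that[of K1]) auto
  qed
  \<comment> \<open>The total coefficient of \<open>(norm e)^2\<close> produced by the cross term:
    \<open>C2\<close> directly, the rest from Young's inequality, which spends half of the decay
    \<sigma> in \<open>w\<close>.\<close>
  define C4 where "C4 = C2 + C1\<^sup>2 / (2 * \<sigma>)"
  have C4: "C4 > 0" using C1 C2 J by (simp add: C4_def add_pos_nonneg)
  \<comment> \<open>The first bound leaves half of \<beta> after the cross term is absorbed; the
    second keeps the quadratic form of \<open>P\<close> positive definite.\<close>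
  define \<epsilon> where "\<epsilon> = min (\<beta> / (2 * C4)) (1 / (2 * C3 * sqrt k))"
  have \<epsilon>: "\<epsilon> > 0" using B C4 C3 k by (simp add: \<epsilon>_def)
  have \<epsilon>1: "\<epsilon> * C4 \<le> \<beta> / 2"
  proof -
    have "\<epsilon> * C4 \<le> \<beta> / (2 * C4) * C4" using C4 by (intro mult_right_mono) (auto simp: \<epsilon>_def)
    then show ?thesis using C4 by simp
  qed
  have \<epsilon>2: "(2 * \<epsilon> * C3)\<^sup>2 * k \<le> 1"
  proof -
    have "\<epsilon> * (2 * C3 * sqrt k) \<le> 1 / (2 * C3 * sqrt k) * (2 * C3 * sqrt k)"
      using C3 k by (intro mult_right_mono) (auto simp: \<epsilon>_def)
    also have "\<dots> = 1" using C3 k by simp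
    finally have "(\<epsilon> * (2 * C3 * sqrt k))\<^sup>2 \<le> 1\<^sup>2" using \<epsilon> C3 k by (intro power_mono) auto
    then show ?thesis using k by (simp add: power_mult_distrib mult_ac)
  qed
  text \<open>The energy \<open>M e \<bullet> e + (norm w)\<^sup>2 / k\<close> alone decreases only in \<open>e\<close>; the cross term adds decay
    in \<open>w\<close>, and weighting it by \<open>M\<close> cancels the inverse \<open>N\<close> in its derivative.\<close>
  define P where "P = (\<lambda>(e, w). (M e + \<epsilon> *\<^sub>R M (Jt w), (1 / k) *\<^sub>R w + \<epsilon> *\<^sub>R J (M e)))"
  define c where "c = min (1 / 2) (1 / (2 * k))"
  define \<gamma> where "\<gamma> = min (\<beta> / 2) (\<epsilon> * \<sigma> / 2)"
  have nrm: "(norm (e, w))\<^sup>2 = (norm e)\<^sup>2 + (norm w)\<^sup>2" for e :: 'a and w :: 'b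
    by (simp add: norm_Pair)
  have MJ: "e \<bullet> M (Jt w) = w \<bullet> J (M e)" for e w by (metis M(1) J(1) inner_commute)
  show thesis
  proof (rule that[of P c \<gamma>])
    show "bounded_linear P"
      unfolding P_def case_prod_beta
      by (intro bounded_linear_Pair bounded_linear_add bounded_linear_compose[OF bounded_linear_scaleR_right]
          bounded_linear_compose[OF JMl] bounded_linear_compose[OF MJtl] bounded_linear_compose[OF lin(1)]
          bounded_linear_fst bounded_linear_snd)
    show "u \<bullet> P v = P u \<bullet> v" for u v
      using MJ[of "fst u" "snd v"] MJ[of "fst v" "snd u"] M(1)[of "fst u" "fst v"]
      by (simp add: P_def case_prod_beta inner_prod_def inner_add_left inner_add_right inner_commute)
    show "c > 0" "\<gamma> > 0" using k B \<epsilon> J by (auto simp: c_def \<gamma>_def)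
    show "c * (norm v)\<^sup>2 \<le> v \<bullet> P v" for v
    proof (cases v)
      case (Pair e w)
      have "v \<bullet> P v = e \<bullet> M e + 2 * \<epsilon> * (e \<bullet> M (Jt w)) + (1 / k) * (norm w)\<^sup>2"
        using MJ[of e w] by (simp add: Pair P_def inner_add_right power2_norm_eq_inner)
      moreover have "2 * \<epsilon> * (e \<bullet> M (Jt w)) \<ge> - (2 * \<epsilon> * (C3 * (norm e * norm w)))"
        using C3(2)[of e w] \<epsilon> mult_left_mono[of "- (C3 * (norm e * norm w))" "e \<bullet> M (Jt w)" "2 * \<epsilon>"] by simp
      moreover have "2 * \<epsilon> * (C3 * (norm e * norm w)) \<le> 1 / 2 * (norm e)\<^sup>2 + 1 / (2 * k) * (norm w)\<^sup>2"
      proof -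
        have "(2 * \<epsilon> * C3) * (norm w * norm e) \<le> 1 / 2 * (norm e)\<^sup>2 + (2 * \<epsilon> * C3)\<^sup>2 / (2 * 1) * (norm w)\<^sup>2"
          by (rule young_ineq) simp
        moreover have "(2 * \<epsilon> * C3)\<^sup>2 / (2 * 1) * (norm w)\<^sup>2 \<le> 1 / (2 * k) * (norm w)\<^sup>2"
          using \<epsilon>2 k by (intro mult_right_mono) (auto simp: field_simps)
        ultimately show ?thesis by (simp add: mult_ac)
      qed
      moreover have "c * (norm v)\<^sup>2 \<le> 1 / 2 * (norm e)\<^sup>2 + 1 / (2 * k) * (norm w)\<^sup>2"
        unfolding Pair nrm distrib_left by (intro add_mono mult_right_mono) (auto simp: c_def)
      moreover have "1 / k * (norm w)\<^sup>2 = 2 * (1 / (2 * k) * (norm w)\<^sup>2)" using k by simp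
      ultimately show ?thesis using M(2)[of e] by linarith
    qed
    show "P (e, w) \<bullet> (- N (B e + Jt w), k *\<^sub>R J e) \<le> - \<gamma> * (norm (e, w))\<^sup>2" for e w
    proof -
      define y where "y = B e + Jt w"
      have MN: "M x \<bullet> N y = x \<bullet> y" for x using M(1)[of x "N y"] M(3)[of y] by simp
      have "P (e, w) \<bullet> (- N (B e + Jt w), k *\<^sub>R J e)
          = - ((e + \<epsilon> *\<^sub>R Jt w) \<bullet> y) + w \<bullet> J e + \<epsilon> * (k * (J (M e) \<bullet> J e))"
        using k by (simp add: P_def MN inner_add_left y_def[symmetric] algebra_simps)
      \<comment> \<open>\<open>e \<bullet> Jt w\<close> and \<open>w \<bullet> J e\<close> cancel by
        adjointness. What survives includes \<open>- \<epsilon> * (norm (Jt w))^2\<close>, the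
        source of the decay in \<open>w\<close>.\<close>
      also have "\<dots> = - (e \<bullet> B e) - \<epsilon> * (Jt w \<bullet> B e) - \<epsilon> * (norm (Jt w))\<^sup>2 + \<epsilon> * (k * (J (M e) \<bullet> J e))"
        using J(1)[of w e]
        by (simp add: y_def inner_add_left inner_add_right power2_norm_eq_inner inner_commute[of e "Jt w"] algebra_simps)
      also have "\<dots> \<le> - (\<beta> * (norm e)\<^sup>2) + \<epsilon> * (C1 * (norm e * norm w)) - \<epsilon> * (\<sigma> * (norm w)\<^sup>2) + \<epsilon> * (C2 * (norm e)\<^sup>2)"
      proof -
        have "\<epsilon> * - (Jt w \<bullet> B e) \<le> \<epsilon> * (C1 * (norm e * norm w))"
          using C1(2)[of w e] \<epsilon> by (intro mult_left_mono) auto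
        moreover have "\<epsilon> * (\<sigma> * (norm w)\<^sup>2) \<le> \<epsilon> * (norm (Jt w))\<^sup>2" "\<epsilon> * (k * (J (M e) \<bullet> J e)) \<le> \<epsilon> * (C2 * (norm e)\<^sup>2)"
          using J(3) C2(2) \<epsilon> by (auto intro!: mult_left_mono simp del: mult_le_cancel_left_pos)
        ultimately show ?thesis using B(2)[of e] by simp
      qed
      also have "\<dots> \<le> - (\<beta> * (norm e)\<^sup>2) + \<epsilon> * (\<sigma> / 2 * (norm w)\<^sup>2 + C1\<^sup>2 / (2 * \<sigma>) * (norm e)\<^sup>2) - \<epsilon> * (\<sigma> * (norm w)\<^sup>2) + \<epsilon> * (C2 * (norm e)\<^sup>2)"
        using mult_left_mono[OF young_ineq[OF J(2), of C1 "norm e" "norm w"], of \<epsilon>] \<epsilon> by simp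
      also have "\<dots> = - ((\<beta> - \<epsilon> * C4) * (norm e)\<^sup>2 + \<epsilon> * \<sigma> / 2 * (norm w)\<^sup>2)"
        by (simp add: C4_def algebra_simps)
      also have "\<dots> \<le> - (\<gamma> * (norm e)\<^sup>2 + \<gamma> * (norm w)\<^sup>2)"
        using \<epsilon>1 unfolding neg_le_iff_le by (intro add_mono mult_right_mono) (auto simp: \<gamma>_def)
      finally show ?thesis by (simp add: nrm algebra_simps)
    qed
  qed
qed

section \<open>Linear equations with a varying coercive matrix\<close>

lemma has_derivative_zero_if_quadratic:
  assumes R: "R > 0" and q: "\<And>w. norm (w - z) < R \<Longrightarrow> norm (q w) \<le> C * (norm (w - z))\<^sup>2"
  shows "(q has_derivative (\<lambda>_. 0)) (at z)"
  unfolding has_derivative_at_alt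
proof (intro conjI allI impI bounded_linear_zero)
  fix e :: real assume e: "e > 0"
  have qz: "q z = 0" using q[of z] R by simp
  define d where "d = min R (e / (\<bar>C\<bar> + 1))"
  have "d > 0" using e R by (simp add: d_def)
  moreover have "norm (q y - q z - 0) \<le> e * norm (y - z)" if y: "norm (y - z) < d" for y
  proof -
    have "norm (q y - q z - 0) \<le> C * (norm (y - z))\<^sup>2" using q[of y] y qz by (simp add: d_def)
    also have "\<dots> \<le> (\<bar>C\<bar> + 1) * norm (y - z) * norm (y - z)"
      unfolding power2_eq_square mult.assoc by (intro mult_right_mono) auto
    also have "\<dots> \<le> e * norm (y - z)"
      using y by (intro mult_right_mono) (auto simp: d_def field_simps)
    finally show ?thesis .
  qed
  ultimately show "\<exists>d>0. \<forall>y. norm (y - z) < d \<longrightarrow> norm (q y - q z - 0) \<le> e * norm (y - z)" by blast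
qed

lemma coercive_norm_le:
  fixes M :: "real^'n^'n"
  assumes "(norm v)\<^sup>2 \<le> v \<bullet> (M *v v)"
  shows "norm v \<le> norm (M *v v)"
proof (cases "v = 0")
  case False
  have "norm v * norm v \<le> norm v * norm (M *v v)"
    using assms norm_cauchy_schwarz[of v "M *v v"] by (simp add: power2_eq_square)
  then show ?thesis using False by simp
qed simp

context
  fixes M :: "'a::euclidean_space \<Rightarrow> real^'n^'n" and g y :: "'a \<Rightarrow> real^'n"
  assumes M: "smooth_lip M" and g: "smooth_lip g"
    and coercive: "\<And>z v. (norm v)\<^sup>2 \<le> v \<bullet> (M z *v v)"
    and y: "\<And>z. M z *v y z = g z"
begin

text \<open>Subtracting the equations at \<open>u\<close> and \<open>v\<close> gives
  \<open>M u (y u - y v) = (g u - g v) + (M v - M u) y v\<close>, and coercivity removes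
  \<open>M u\<close> at no cost.\<close>

lemma coercive_solution_lipschitz: "\<exists>L. L-lipschitz_on (cball 0 R) y"
proof -
  obtain K where K: "K > 0" "\<And>A v. norm ((A :: real^'n^'n) *v v) \<le> norm A * norm v * K"
    using bounded_bilinear.pos_bounded[OF bounded_bilinear_matrix_vector_mult] by blast
  obtain C where C: "C > 0" "\<And>x. x \<in> cball 0 R \<Longrightarrow> norm (g x) \<le> C" using smooth_lip_bounded[OF g, where R=R] by blast
  obtain Lg where Lg: "Lg-lipschitz_on (cball 0 R) g" using g unfolding smooth_lip_def by blast
  obtain LM where LM: "LM-lipschitz_on (cball 0 R) M" using M unfolding smooth_lip_def by blast
  have L0: "Lg \<ge> 0" "LM \<ge> 0" using Lg LM lipschitz_on_nonneg by blast+
  have "(Lg + LM * C * K)-lipschitz_on (cball 0 R) y"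
  proof (rule lipschitz_onI)
    fix u v :: 'a assume uv: "u \<in> cball 0 R" "v \<in> cball 0 R"
    have yv: "norm (y v) \<le> C" using coercive_norm_le[OF coercive, of "y v" v] C(2)[OF uv(2)] y by simp
    have "M u *v (y u - y v) = (g u - g v) + (M v - M u) *v y v"
      by (simp add: matrix_vector_mult_diff_distrib matrix_vector_mult_diff_rdistrib y)
    then have "norm (y u - y v) \<le> norm ((g u - g v) + (M v - M u) *v y v)"
      using coercive_norm_le[OF coercive, of "y u - y v" u] by simp
    also have "\<dots> \<le> norm (g u - g v) + norm (M v - M u) * norm (y v) * K"
      by (intro order_trans[OF norm_triangle_ineq] add_mono K) auto
    also have "\<dots> \<le> Lg * norm (u - v) + (LM * norm (u - v)) * C * K"
      using lipschitz_on_normD[OF Lg uv] lipschitz_on_normD[OF LM uv(2) uv(1)] K C L0 yv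
      by (intro add_mono mult_mono) (auto simp: norm_minus_commute)
    finally show "dist (y u) (y v) \<le> (Lg + LM * C * K) * dist u v"
      by (simp add: dist_norm algebra_simps)
  qed (use K C L0 in auto)
  then show ?thesis ..
qed

text \<open>Freezing the matrix at \<open>z0\<close> turns the equation into
  \<open>y = N (g + (M z0 - M z) y)\<close>. Both factors of the correction are Lipschitz and vanish
  at \<open>z0\<close>, so the correction has derivative zero there.\<close>

lemma coercive_solution_has_derivative:
  assumes g0: "g z0 = 0" and g': "(g has_derivative g') (at z0)"
    and N: "\<And>v. N *v (M z0 *v v) = v"
  shows "(y has_derivative (\<lambda>v. N *v g' v)) (at z0)"
proof -
  define R where "R = norm z0 + 1"
  obtain K where K: "K > 0" "\<And>A v. norm ((A :: real^'n^'n) *v v) \<le> norm A * norm v * K"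
    using bounded_bilinear.pos_bounded[OF bounded_bilinear_matrix_vector_mult] by blast
  obtain Ly where Ly: "Ly-lipschitz_on (cball 0 R) y" using coercive_solution_lipschitz by blast
  obtain LM where LM: "LM-lipschitz_on (cball 0 R) M" using M unfolding smooth_lip_def by blast
  have L0: "Ly \<ge> 0" "LM \<ge> 0" using Ly LM lipschitz_on_nonneg by blast+
  have y0: "y z0 = 0" using N[of "y z0"] y[of z0] g0 by simp
  have "((\<lambda>z. (M z0 - M z) *v y z) has_derivative (\<lambda>_. 0)) (at z0)"
  proof (rule has_derivative_zero_if_quadratic)
    fix z assume z: "norm (z - z0) < 1"
    have in_ball: "z \<in> cball 0 R" "z0 \<in> cball 0 R"
      using z norm_triangle_sub[of z z0] by (auto simp: R_def)
    have "norm ((M z0 - M z) *v y z) \<le> norm (M z0 - M z) * norm (y z) * K" by (rule K)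
    also have "\<dots> \<le> (LM * norm (z - z0)) * (Ly * norm (z - z0)) * K"
      using lipschitz_on_normD[OF LM in_ball(2,1)] lipschitz_on_normD[OF Ly in_ball] y0 K L0
      by (intro mult_mono) (auto simp: norm_minus_commute)
    finally show "norm ((M z0 - M z) *v y z) \<le> (LM * Ly * K) * (norm (z - z0))\<^sup>2"
      by (simp add: power2_eq_square mult_ac)
  qed simp
  from has_derivative_add[OF g' this]
  have "((\<lambda>z. N *v (g z + (M z0 - M z) *v y z)) has_derivative (\<lambda>v. N *v (g' v + 0))) (at z0)"
    by (rule bounded_linear.has_derivative[OF matrix_vector_mul_bounded_linear])
  moreover have "N *v (g z + (M z0 - M z) *v y z) = y z" for z
    using N[of "y z"] by (simp add: matrix_vector_mult_diff_rdistrib y)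
  ultimately show ?thesis by simp
qed

end

section \<open>The mass matrix and the gain condition\<close>

lemma sppid_mass_mult:
  "sppid_mass h kd x *v u
     = u + kd *\<^sub>R (transpose (jacobian h (at x)) *v (jacobian h (at x) *v u))"
  by (simp add: sppid_mass_def matrix_vector_mult_add_rdistrib matrix_vector_mul_assoc
      flip: scaleR_matrix_vector_assoc)

lemma inner_sppid_mass:
  "u \<bullet> (sppid_mass h kd x *v v)
     = u \<bullet> v + kd * ((jacobian h (at x) *v u) \<bullet> (jacobian h (at x) *v v))"
  by (simp add: sppid_mass_mult inner_add_right inner_commute[of u "transpose _ *v _"] inner_transpose_mult)
     (simp add: inner_commute)

lemma sppid_mass_coercive:
  "kd \<ge> 0 \<Longrightarrow> (norm v)\<^sup>2 \<le> v \<bullet> (sppid_mass h kd x *v v)"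
  by (simp add: inner_sppid_mass power2_norm_eq_inner)

text \<open>\<open>matrix_inv\<close> is a choice that is an inverse once one exists; coercivity
  gives a trivial kernel and hence invertibility.\<close>

lemma sppid_mass_inverse:
  assumes "kd \<ge> 0"
  shows "sppid_mass h kd x *v (matrix_inv (sppid_mass h kd x) *v v) = v"
    and "matrix_inv (sppid_mass h kd x) *v (sppid_mass h kd x *v v) = v"
proof -
  let ?M = "sppid_mass h kd x"
  have "\<forall>v. ?M *v v = 0 \<longrightarrow> v = 0"
    using coercive_norm_le[OF sppid_mass_coercive[OF assms]] by (metis norm_le_zero_iff norm_zero)
  then have "invertible ?M"
    unfolding invertible_left_inverse by (simp add: matrix_left_invertible_ker)
  then have "?M ** matrix_inv ?M = mat 1 \<and> matrix_inv ?M ** ?M = mat 1"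
    unfolding invertible_def matrix_inv_def by (rule someI_ex)
  then show "?M *v (matrix_inv ?M *v v) = v" "matrix_inv ?M *v (?M *v v) = v"
    by (simp_all add: matrix_vector_mul_assoc)
qed

text \<open>The extended-real gain condition has to be turned into a real constant \<open>l\<close>.
  For a nontrivial kernel this is the attained minimum. For a trivial kernel
  \<open>lambda_sosc\<close> is \<infinity> and the quotient is 0, and then any sufficiently large
  \<open>l\<close> serves.\<close>

lemma augmented_hessian_L_pos:
  assumes H: "transpose (hessian_L f h x \<nu>) = hessian_L f h x \<nu>"
    and licq: "LICQ h x" and sosc: "SOSC f h x \<nu>"
    and kp: "ereal kp > k_bar f h x \<nu>" and v: "v \<noteq> 0"
  shows "v \<bullet> (hessian_L f h x \<nu> *v v) + kp * (norm (jacobian h (at x) *v v))\<^sup>2 > 0"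
proof -
  let ?J = "jacobian h (at x)" and ?H = "hessian_L f h x \<nu>"
  have rank: "rank ?J = CARD('b)" using licq by (simp add: LICQ_def)
  define s where "s = (sigma_min ?J)\<^sup>2"
  define n where "n = 2 * (spectral_norm ?H)\<^sup>2"
  have s: "s > 0" using sigma_min_sq_full_rank(1)[OF rank] by (simp add: s_def)
  have n: "n \<ge> 0" by (simp add: n_def)
  have kp0: "kp > 0"
    and kp1: "(ereal n / lambda_sosc f h x \<nu> - ereal (lambda_min ?H)) / ereal s < ereal kp"
    using kp by (auto simp: k_bar_def s_def n_def)
  \<comment> \<open>The comparison leaves \<open>ereal\<close> as soon as the quotient has a real
    value: \<open>n / l\<close> in the first case below, 0 in the second.\<close>
  have bound: "r < lambda_min ?H + kp * s" if "ereal n / lambda_sosc f h x \<nu> = ereal r" for r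
    using kp1 s by (simp add: that field_simps)
  have "\<exists>l>0. (\<forall>v. ?J *v v = 0 \<longrightarrow> l * (norm v)\<^sup>2 \<le> v \<bullet> (?H *v v)) \<and> n / l < lambda_min ?H + kp * s"
  proof (cases "\<exists>w. ?J *v w = 0 \<and> w \<noteq> 0")
    case True
    from lambda_sosc_attained[OF True, of f \<nu>] obtain u where
      u: "lambda_sosc f h x \<nu> = ereal (u \<bullet> (?H *v u))" by blast
    define l where "l = u \<bullet> (?H *v u)"
    have l: "lambda_sosc f h x \<nu> = ereal l" using u by (simp add: l_def)
    have l0: "l > 0" using lambda_sosc_pos[OF sosc] l by simp
    have "l * (norm v)\<^sup>2 \<le> v \<bullet> (?H *v v)" if v: "?J *v v = 0" for v
    proof (cases "v = 0")
      case False
      let ?w = "(1 / norm v) *\<^sub>R v"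
      have "?w \<in> {v. ?J *v v = 0 \<and> norm v = 1}"
        using False v by (simp add: matrix_vector_mult_scaleR)
      then have "lambda_sosc f h x \<nu> \<le> ereal (?w \<bullet> (?H *v ?w))"
        unfolding lambda_sosc_def by (rule INF_lower)
      then have "l \<le> ?w \<bullet> (?H *v ?w)" unfolding l by (simp only: ereal_less_eq)
      also have "\<dots> = v \<bullet> (?H *v v) / (norm v)\<^sup>2"
        by (simp add: matrix_vector_mult_scaleR power2_eq_square)
      finally show ?thesis using False by (simp add: field_simps)
    qed simp
    moreover have "n / l < lambda_min ?H + kp * s" using l0 by (intro bound) (simp add: l)
    ultimately show ?thesis using l0 by blast
  next
    case False
    then have "{v. ?J *v v = 0 \<and> norm v = 1} = {}" by force
    then have "lambda_sosc f h x \<nu> = \<infinity>"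
      by (simp only: lambda_sosc_def) (simp add: top_ereal_def)
    then have pos: "0 < lambda_min ?H + kp * s" by (intro bound) (simp add: zero_ereal_def)
    define q where "q = lambda_min ?H + kp * s"
    have q: "q > 0" using pos by (simp add: q_def)
    \<comment> \<open>Makes \<open>q * l = n + q\<close> exceed \<open>n\<close>; the bound on the
      kernel concerns only the zero vector.\<close>
    define l where "l = n / q + 1"
    have l: "l > 0" using q n by (simp add: l_def add_nonneg_pos)
    moreover have "n < q * l" using q by (simp add: l_def field_simps)
    then have "n / l < lambda_min ?H + kp * s" using l by (simp add: divide_less_eq q_def)
    moreover have "\<forall>v. ?J *v v = 0 \<longrightarrow> l * (norm v)\<^sup>2 \<le> v \<bullet> (?H *v v)" using False by force
    ultimately show ?thesis by blast
  qed
  then obtain l where l: "l > 0" "\<And>v. ?J *v v = 0 \<Longrightarrow> l * (norm v)\<^sup>2 \<le> v \<bullet> (?H *v v)"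
    "n / l < lambda_min ?H + kp * s" by blast
  show ?thesis
    by (rule augmented_hessian_pos[OF rank H l(1,2) _ _ v]) (use kp0 l(3) in \<open>auto simp: n_def s_def\<close>)
qed

theorem theorem4p2:
  fixes f :: "real^'n \<Rightarrow> real" and h :: "real^'n \<Rightarrow> real^'p"
    and xs :: "real^'n" and \<nu>s :: "real^'p"
  assumes "C2 f" and "C2 h"
    and "kkt_point f h xs \<nu>s"
    and "LICQ h xs"
    and "SOSC f h xs \<nu>s"
  shows "\<forall>ki kd kp :: real. ki > 0 \<and> kd \<ge> 0 \<and> ereal kp > k_bar f h xs \<nu>s \<longrightarrow>
           locally_exponentially_stable (sppid_field f h kp ki kd) (xs, \<nu>s)"
proof (intro allI impI, elim conjE)
  fix ki kd kp :: real
  assume ki: "ki > 0" and kd: "kd \<ge> 0" and kp: "ereal kp > k_bar f h xs \<nu>s"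
  define J where "J x = jacobian h (at x)" for x
  define H where "H = hessian_L f h xs \<nu>s"
  define M where "M x = sppid_mass h kd x" for x
  define B where "B = H + kp *\<^sub>R (transpose (J xs) ** J xs)"
  have f_lip: "smooth_lip (gradient f)" and J_lip: "smooth_lip J" and h_lip: "smooth_lip h"
    unfolding J_def
    using C2_smooth_lip_gradient[OF assms(1)] C2_smooth_lip_jacobian[OF assms(2)] C2_smooth_lip[OF assms(2)]
    by blast+
  have hs: "h xs = 0" and kkt: "gradient f xs + transpose (J xs) *v \<nu>s = 0"
    using assms(3) by (auto simp: kkt_point_def J_def)
  have sym: "transpose H = H"
    unfolding H_def hessian_L_def by (intro hessian_symmetric C2_lagrangian assms)
  have B_mult: "B *v v = H *v v + kp *\<^sub>R (transpose (J xs) *v (J xs *v v))" for v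
    by (simp add: B_def matrix_vector_mult_add_rdistrib matrix_vector_mul_assoc flip: scaleR_matrix_vector_assoc)
  have "v \<bullet> (B *v v) > 0" if "v \<noteq> 0" for v
  proof -
    have "v \<bullet> (transpose (J xs) *v (J xs *v v)) = (norm (J xs *v v))\<^sup>2"
      by (subst inner_commute) (simp add: inner_transpose_mult power2_norm_eq_inner)
    then have "v \<bullet> (B *v v) = v \<bullet> (H *v v) + kp * (norm (J xs *v v))\<^sup>2"
      by (simp add: B_mult inner_add_right)
    then show ?thesis
      using augmented_hessian_L_pos[OF sym[unfolded H_def] assms(4,5) kp that] by (simp add: H_def J_def)
  qed
  then obtain \<beta> where \<beta>: "\<beta> > 0" "\<And>v. \<beta> * (norm v)\<^sup>2 \<le> v \<bullet> (B *v v)"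
    using quadratic_form_coercive by blast
  have rank: "rank (J xs) = CARD('p)" using assms(4) by (simp add: LICQ_def J_def)

  \<comment> \<open>The multiplier is split around \<nu>s: the first two terms form the gradient of
    the Lagrangian at \<nu>s, and each of the others has a factor vanishing at the
    equilibrium.\<close>
  define g where "g z = gradient f (fst z) + transpose (J (fst z)) *v \<nu>s + transpose (J (fst z)) *v (snd z - \<nu>s)
      + kp *\<^sub>R (transpose (J (fst z)) *v h (fst z))" for z :: "(real^'n) \<times> (real^'p)"
  define y where "y z = matrix_inv (M (fst z)) *v g z" for z
  have F: "sppid_field f h kp ki kd = (\<lambda>z. (- y z, ki *\<^sub>R h (fst z)))"
    by (simp add: fun_eq_iff sppid_field_def y_def M_def g_def J_def matrix_vector_mult_diff_distrib)
  have Jt_lip: "smooth_lip (\<lambda>z::(real^'n) \<times> (real^'p). transpose (J (fst z)))"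
    by (intro smooth_lip_linear[OF bounded_linear_transpose] smooth_lip_fst J_lip)
  have "smooth_lip (\<lambda>z::(real^'n) \<times> (real^'p). snd z + - \<nu>s)"
    by (intro smooth_lip_add smooth_lip_snd smooth_lip_const)
  then have g_lip: "smooth_lip g"
    unfolding g_def
    by (intro smooth_lip_add smooth_lip_linear[OF bounded_linear_scaleR_right] Jt_lip
        smooth_lip_bilinear[OF bounded_bilinear_matrix_vector_mult] smooth_lip_const smooth_lip_fst f_lip h_lip) simp
  have M_lip: "smooth_lip (\<lambda>z::(real^'n) \<times> (real^'p). M (fst z))"
    unfolding M_def sppid_mass_def J_def[symmetric]
    by (intro smooth_lip_add smooth_lip_const smooth_lip_linear[OF bounded_linear_scaleR_right]
        smooth_lip_bilinear[OF bounded_bilinear_matrix_mult] Jt_lip smooth_lip_fst J_lip)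
  have coercive: "(norm v)\<^sup>2 \<le> v \<bullet> (M x *v v)" for x v
    unfolding M_def by (rule sppid_mass_coercive[OF kd])
  have My: "M (fst z) *v y z = g z" for z
    unfolding y_def M_def by (rule sppid_mass_inverse(1)[OF kd])

  define N where "N = matrix_inv (M xs)"
  have diff: "f differentiable (at x)" "h differentiable (at x)" for x
    using C2_smooth_lip assms(1,2) unfolding smooth_lip_def by blast+
  have fst': "(fst has_derivative fst) (at (xs, \<nu>s))" and snd': "(snd has_derivative snd) (at (xs, \<nu>s))"
    by (auto intro: derivative_eq_intros)
  have h': "((\<lambda>z. h (fst z)) has_derivative (\<lambda>v. J xs *v fst v)) (at (xs, \<nu>s))"
    using has_derivative_compose[OF fst', of h "\<lambda>v. J xs *v v"] diff(2)[of xs]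
    unfolding J_def jacobian_works by simp
  have g': "(g has_derivative (\<lambda>v. B *v fst v + transpose (J xs) *v snd v)) (at (xs, \<nu>s))"
  proof -
    have "gradient (\<lambda>x. lagrangian f h x \<nu>s) = (\<lambda>x. gradient f x + transpose (J x) *v \<nu>s)"
      unfolding J_def using gradient_lagrangian[OF diff] by blast
    moreover have "gradient (\<lambda>x. lagrangian f h x \<nu>s) differentiable (at xs)"
      using C2_smooth_lip_gradient[OF C2_lagrangian[OF assms(1,2)]] unfolding smooth_lip_def by blast
    ultimately have "((\<lambda>x. gradient f x + transpose (J x) *v \<nu>s) has_derivative (\<lambda>v. H *v v)) (at xs)"
      unfolding H_def hessian_L_def hessian_def using jacobian_works by metis
    then have d1: "((\<lambda>z. gradient f (fst z) + transpose (J (fst z)) *v \<nu>s) has_derivative (\<lambda>v. H *v fst v)) (at (xs, \<nu>s))"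
      using has_derivative_compose[OF fst'] by fastforce
    \<comment> \<open>Only the existence of this derivative matters: in the product rule
      \<open>T\<close> is applied to factors that are zero at the equilibrium.\<close>
    obtain T where T: "((\<lambda>z::(real^'n) \<times> (real^'p). transpose (J (fst z))) has_derivative T) (at (xs, \<nu>s))"
      using Jt_lip unfolding smooth_lip_def differentiable_def by blast
    note bil = bounded_bilinear.FDERIV[OF bounded_bilinear_matrix_vector_mult T]
    show ?thesis unfolding g_def
      by (rule has_derivative_eq_rhs[OF has_derivative_add[OF has_derivative_add[OF d1
              bil[OF has_derivative_diff[OF snd' has_derivative_const]]]
            has_derivative_scaleR_right[OF bil[OF h']]]])
         (simp add: fun_eq_iff hs B_mult)
  qed
  have g0: "g (xs, \<nu>s) = 0" using kkt hs by (simp add: g_def)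
  have N: "N *v (M (fst (xs, \<nu>s)) *v v) = v" for v
    unfolding N_def M_def by (simp add: sppid_mass_inverse(2)[OF kd])
  have y': "(y has_derivative (\<lambda>v. N *v (B *v fst v + transpose (J xs) *v snd v))) (at (xs, \<nu>s))"
    using coercive_solution_has_derivative[OF M_lip g_lip coercive My g0 g' N] .
  have F': "(sppid_field f h kp ki kd has_derivative
      (\<lambda>v. (- (N *v (B *v fst v + transpose (J xs) *v snd v)), ki *\<^sub>R (J xs *v fst v)))) (at (xs, \<nu>s))"
    unfolding F by (intro has_derivative_Pair has_derivative_minus has_derivative_scaleR_right y' h')
  \<comment> \<open>The Lipschitz bounds are on balls about the origin; this one contains the unit
    ball about the equilibrium.\<close>
  define R where "R = norm (xs, \<nu>s) + 1"
  obtain L1 where L1: "L1-lipschitz_on (cball 0 R) y"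
    using coercive_solution_lipschitz[OF M_lip g_lip coercive My] by blast
  obtain L2 where L2: "L2-lipschitz_on (cball 0 R) (\<lambda>z::(real^'n) \<times> (real^'p). ki *\<^sub>R h (fst z))"
    using smooth_lip_linear[OF bounded_linear_scaleR_right smooth_lip_fst[OF h_lip]] unfolding smooth_lip_def by blast
  have "(sqrt (L1\<^sup>2 + L2\<^sup>2))-lipschitz_on (cball 0 R) (sppid_field f h kp ki kd)"
    unfolding F using L1 L2 by (intro lipschitz_on_Pair) auto
  moreover have "cball (xs, \<nu>s) 1 \<subseteq> cball 0 R"
  proof
    fix z assume "z \<in> cball (xs, \<nu>s) 1"
    then show "z \<in> cball 0 R"
      using norm_triangle_sub[of z "(xs, \<nu>s)"] by (simp add: R_def dist_norm norm_minus_commute)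
  qed
  ultimately have lip: "(sqrt (L1\<^sup>2 + L2\<^sup>2))-lipschitz_on (cball (xs, \<nu>s) 1) (sppid_field f h kp ki kd)"
    by (rule lipschitz_on_subset)
  obtain P c \<gamma> where P: "bounded_linear P" "\<And>u v. u \<bullet> P v = P u \<bullet> v"
    "c > 0" "\<And>v. c * (norm v)\<^sup>2 \<le> v \<bullet> P v" "\<gamma> > 0"
    "\<And>e \<nu>. P (e, \<nu>) \<bullet> (- (N *v (B *v e + transpose (J xs) *v \<nu>)), ki *\<^sub>R (J xs *v e)) \<le> - \<gamma> * (norm (e, \<nu>))\<^sup>2"
  proof (rule saddle_flow_lyapunov[of "(*v) (M xs)" "(*v) B" "(*v) (J xs)" "(*v) (transpose (J xs))"
        "(*v) N" \<beta> "(sigma_min (J xs))\<^sup>2" ki])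
    show "u \<bullet> (M xs *v v) = (M xs *v u) \<bullet> v" for u v
      by (subst (2) inner_commute) (simp add: M_def inner_sppid_mass inner_commute)
    show "M xs *v (N *v v) = v" for v
      unfolding N_def M_def by (rule sppid_mass_inverse(1)[OF kd])
  qed (use coercive \<beta> ki sigma_min_sq_full_rank[OF rank] inner_transpose_mult in auto)
  show "locally_exponentially_stable (sppid_field f h kp ki kd) (xs, \<nu>s)"
  proof (rule locally_exponentially_stable_linearization[OF lip _ _ F' P(1-5)])
    show "sppid_field f h kp ki kd (xs, \<nu>s) = 0"
      unfolding F y_def g0 by (simp add: hs zero_prod_def)
    show "P v \<bullet> (- (N *v (B *v fst v + transpose (J xs) *v snd v)), ki *\<^sub>R (J xs *v fst v))
        \<le> - \<gamma> * (norm v)\<^sup>2" for v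
      using P(6)[of "fst v" "snd v"] by simp
  qed simp
qed

end
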